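(* (i) Let $\mu \in M^{0}(X)$ be a good measure on a non-compact locally compact Cantor set $X$. Then the compact open values set $S(\mu)$ is group-like and the defective set $\mathfrak{M}_\mu$ is a locally compact, zero-dimensional, metric space (possibly empty). (ii) Conversely, for every countable dense group-like subset $D$ of $[0, 1)$ there is a good probability measure $\mu$ on a non-compact locally compact Cantor set such that $S(\mu) = D$. (iii) For every countable dense group-like subset $D$ of $[0, \infty)$ and any locally compact, zero-dimensional, metric space $A$ (including $A = \emptyset$) there is a good non-defective measure $\mu$ on a non-compact locally compact Cantor set such that $S(\mu) = D$ and $\mathfrak{M}_\mu$ is homeomorphic to $A$.
   Context: A non-compact locally compact Cantor set is a non-compact locally compact metrizable space with no isolated points and with a countable basis of compact open sets. For such a space $X$, $M(X)$ is the set of Borel measures (finite or infinite) on $X$ that are full (every non-empty open set has positive measure) and non-atomic. For an infinite $\mu\in M(X)$ the defective set is $\mathfrak{M}_\mu = \{x \in X : \mu(U)=\infty \text{ for every compact open } U \ni x\}$ (with the induced topology); for finite $\mu$, $\mathfrak{M}_\mu=\emptyset$. An infinite $\mu\in M(X)$ is non-defective if $\mu(\mathfrak{M}_\mu)=0$. $M^0(X)$ is the set of $\mu\in M(X)$ that are either finite (normalized so that $\mu(X)=1$) or infinite and non-defective. The compact open values set is $S(\mu)=\{\mu(U): U \text{ compact open in } X,\ \mu(U)<\infty\}$. $\mu\in M^0(X)$ is good if for all compact open $U,V\subset X$ with $\mu(U)<\mu(V)$ there is a compact open $W\subset V$ with $\mu(W)=\mu(U)$. A countable dense subset $D$ of $[0,a)$,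 $a\in(0,\infty]$, is group-like if there is an additive subgroup $G$ of $\mathbb{R}$ with $D=G\cap[0,a)$. In (i), $S(\mu)$ is regarded as a subset of $[0,\mu(X))$.
   Formalization: The locally compact, zero-dimensional, metric space A in (iii) is required to be separable (second countable), since a defective set is a subspace of a second countable X and e.g. an uncountable discrete A is impossible; (i) also concludes separability. *)

theory Defs
  imports "HOL-Probability.Probability"
begin

definition compact_open :: "'a topology \<Rightarrow> 'a set \<Rightarrow> bool" where
  "compact_open X U \<longleftrightarrow> compactin X U \<and> openin X U"

definition noncompact_lc_Cantor :: "'a topology \<Rightarrow> bool" where
  "noncompact_lc_Cantor X \<longleftrightarrow>
     \<not> compact_space X \<and> locally_compact_space X \<and> metrizable_space X \<and>
     (\<forall>x \<in> topspace X. \<not> openin X {x}) \<and>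
     (\<exists>\<B>. countable \<B> \<and> (\<forall>V \<in> \<B>. compact_open X V) \<and>
          (\<forall>U x. openin X U \<and> x \<in> U \<longrightarrow> (\<exists>V \<in> \<B>. x \<in> V \<and> V \<subseteq> U)))"

text \<open>Since \<^term>\<open>sigma\<close> fixes the underlying set, a Borel measure on \<open>X\<close> also has
  \<open>space \<mu> = topspace X\<close>.\<close>

definition borel_measure_on :: "'a topology \<Rightarrow> 'a measure \<Rightarrow> bool" where
  "borel_measure_on X \<mu> \<longleftrightarrow> sets \<mu> = sets (sigma (topspace X) {U. openin X U})"

definition full_measure :: "'a topology \<Rightarrow> 'a measure \<Rightarrow> bool" where
  "full_measure X \<mu> \<longleftrightarrow> (\<forall>U. openin X U \<and> U \<noteq> {} \<longrightarrow> emeasure \<mu> U > 0)"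

definition atom_of :: "'a measure \<Rightarrow> 'a set \<Rightarrow> bool" where
  "atom_of \<mu> E \<longleftrightarrow> E \<in> sets \<mu> \<and> emeasure \<mu> E > 0 \<and>
     (\<forall>B \<in> sets \<mu>. B \<subseteq> E \<and> emeasure \<mu> B < emeasure \<mu> E \<longrightarrow> emeasure \<mu> B = 0)"

definition non_atomic :: "'a measure \<Rightarrow> bool" where
  "non_atomic \<mu> \<longleftrightarrow> (\<nexists>E. atom_of \<mu> E)"

definition meas_M :: "'a topology \<Rightarrow> 'a measure set" where
  "meas_M X = {\<mu>. borel_measure_on X \<mu> \<and> full_measure X \<mu> \<and> non_atomic \<mu>}"

definition defective_set :: "'a topology \<Rightarrow> 'a measure \<Rightarrow> 'a set" where
  "defective_set X \<mu> =
     (if emeasure \<mu> (topspace X) = \<infinity>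
      then {x \<in> topspace X. \<forall>U. compact_open X U \<and> x \<in> U \<longrightarrow> emeasure \<mu> U = \<infinity>}
      else {})"

definition non_defective :: "'a topology \<Rightarrow> 'a measure \<Rightarrow> bool" where
  "non_defective X \<mu> \<longleftrightarrow>
     emeasure \<mu> (topspace X) = \<infinity> \<and> emeasure \<mu> (defective_set X \<mu>) = 0"

text \<open>On the spaces considered here the defective set is closed, hence Borel; so the
  junk value \<open>0\<close> of \<^term>\<open>emeasure\<close> on non-measurable sets plays no role in
  \<open>non_defective\<close>.\<close>

definition meas_M0 :: "'a topology \<Rightarrow> 'a measure set" where
  "meas_M0 X =
     {\<mu> \<in> meas_M X. emeasure \<mu> (topspace X) = 1 \<or> non_defective X \<mu>}"

definition compact_open_values :: "'a topology \<Rightarrow> 'a measure \<Rightarrow> real set" where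
  "compact_open_values X \<mu> =
     {measure \<mu> U | U. compact_open X U \<and> emeasure \<mu> U < \<infinity>}"

text \<open>Goodness is a property of members of \<open>M\<^sup>0(X)\<close>, so membership is part of the definition.\<close>

definition good_measure :: "'a topology \<Rightarrow> 'a measure \<Rightarrow> bool" where
  "good_measure X \<mu> \<longleftrightarrow> \<mu> \<in> meas_M0 X \<and>
     (\<forall>U V. compact_open X U \<and> compact_open X V \<and> emeasure \<mu> U < emeasure \<mu> V \<longrightarrow>
        (\<exists>W. compact_open X W \<and> W \<subseteq> V \<and> emeasure \<mu> W = emeasure \<mu> U))"

text \<open>The interval \<open>[0,a)\<close> of reals, where \<open>a\<close> may be infinite.\<close>

definition real_ray :: "ennreal \<Rightarrow> real set" where
  "real_ray a = {x. 0 \<le> x \<and> ennreal x < a}"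

definition real_additive_subgroup :: "real set \<Rightarrow> bool" where
  "real_additive_subgroup G \<longleftrightarrow>
     0 \<in> G \<and> (\<forall>x \<in> G. \<forall>y \<in> G. x + y \<in> G) \<and> (\<forall>x \<in> G. - x \<in> G)"

definition countable_dense_group_like :: "ennreal \<Rightarrow> real set \<Rightarrow> bool" where
  "countable_dense_group_like a D \<longleftrightarrow>
     countable D \<and> D \<subseteq> real_ray a \<and> real_ray a \<subseteq> closure D \<and>
     (\<exists>G. real_additive_subgroup G \<and> D = G \<inter> real_ray a)"

text \<open>Spaces are taken to be separable, as is customary in dimension theory: the defective
  set is a subspace of a second countable space, so an uncountable discrete space, for
  instance, is not homeomorphic to any defective set. The relation
  \<^term>\<open>X dim_le 0\<close> (small inductive dimension at most 0, i.e. a base of clopen sets)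
  includes the empty space.\<close>

definition lc_zero_dim_metric_space :: "'a topology \<Rightarrow> bool" where
  "lc_zero_dim_metric_space X \<longleftrightarrow>
     metrizable_space X \<and> second_countable X \<and> locally_compact_space X \<and> X dim_le 0"

end

theory Submission
  imports Defs
begin

text \<open>
  In (i), goodness makes the set of values closed under differences, and under those sums that stay
  below the total mass; the defective set being null gives compact open sets of finite measure
  close to the total mass, and shrinking neighbourhoods of a non-defective point (which is null,
  the measure being non-atomic) give arbitrarily small positive values.

  For (ii) and (iii) the space is the Stone space of a countable ring \<open>R\<close> of Borel subsets of a
  half-line \<open>\<Omega>\<close>: with \<open>R = {r\<^sub>0, r\<^sub>1, \<dots>}\<close> one codes \<open>x\<close> by the sequence of truth values of
  \<open>x \<in> r\<^sub>n\<close>, takes the closure of the codes in the Cantor space, removes the zero sequence and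
  pushes Lebesgue measure forward. Its compact open sets are exactly the sets \<open>{f. f n}\<close>, of measure
  \<open>|r\<^sub>n|\<close>, so everything reduces to properties of \<open>R\<close>. For (ii), \<open>R\<close> consists of the finite unions
  of intervals \<open>[g,h)\<close> with \<open>g, h \<in> D\<close>. For (iii), cut the half-line into blocks of equal length,
  attach to them points of \<open>A\<close> so that every non-empty compact open subset of \<open>A\<close> is visited
  infinitely often and infinitely many blocks get no point, and let \<open>R\<close> consist of the sets that
  are locally finite unions of intervals and near infinity are the union of the blocks whose point
  lies in some compact open \<open>B\<close>. Such a set has infinite measure unless \<open>B = {}\<close>, so the
  defective ultrafilters are the ultrafilters of compact open subsets of \<open>A\<close>, that is, the points
  of \<open>A\<close>.
\<close>

section \<open>The values of a good measure\<close>

lemma compact_open_empty [simp]: "compact_open X {}"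
  by (simp add: compact_open_def)

lemma compact_open_Un:
  "compact_open X U \<Longrightarrow> compact_open X V \<Longrightarrow> compact_open X (U \<union> V)"
  by (simp add: compact_open_def compactin_Un openin_Un)

lemma compact_open_Diff:
  assumes "Hausdorff_space X" "compact_open X U" "compact_open X V"
  shows "compact_open X (U - V)"
proof -
  have "closedin X U" "closedin X V"
    using assms by (auto simp: compact_open_def compactin_imp_closedin)
  then show ?thesis
    using assms by (auto simp: compact_open_def intro: closed_compactin closedin_diff openin_diff)
qed

lemma compact_open_Int:
  assumes "Hausdorff_space X" "compact_open X U" "compact_open X V"
  shows "compact_open X (U \<inter> V)"
  using assms by (metis compact_open_Diff Diff_Diff_Int)

lemma compact_open_UN:
  "finite I \<Longrightarrow> (\<And>i. i \<in> I \<Longrightarrow> compact_open X (U i)) \<Longrightarrow> compact_open X (\<Union>i\<in>I. U i)"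
  by (induction I rule: finite_induct) (auto intro: compact_open_Un)

lemma compact_open_finite_Union_of_base:
  assumes opn: "\<And>V. V \<in> \<B> \<Longrightarrow> openin X V"
    and base: "\<And>U x. openin X U \<Longrightarrow> x \<in> U \<Longrightarrow> \<exists>V\<in>\<B>. x \<in> V \<and> V \<subseteq> U"
    and U: "compact_open X U"
  obtains \<F> where "finite \<F>" "\<F> \<subseteq> \<B>" "U = \<Union>\<F>"
proof -
  have "U \<subseteq> \<Union>{V \<in> \<B>. V \<subseteq> U}"
    using base U unfolding compact_open_def by blast
  moreover have "\<forall>V \<in> {V \<in> \<B>. V \<subseteq> U}. openin X V"
    using opn by auto
  ultimately obtain \<F> where "finite \<F>" "\<F> \<subseteq> {V \<in> \<B>. V \<subseteq> U}" "U \<subseteq> \<Union>\<F>"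
    using U unfolding compact_open_def compactin_def by meson
  then show ?thesis
    using that by (metis (no_types, lifting) Sup_least mem_Collect_eq subset_antisym subset_iff)
qed

text \<open>By compactness each such set is the union of a finite subfamily of a countable base, and
  there are only countably many finite subfamilies.\<close>

lemma countable_compact_open:
  assumes "second_countable X"
  shows "countable {U. compact_open X U}"
proof -
  obtain \<B> where \<B>: "countable \<B>" "\<And>V. V \<in> \<B> \<Longrightarrow> openin X V"
    "\<And>U x. openin X U \<Longrightarrow> x \<in> U \<Longrightarrow> \<exists>V\<in>\<B>. x \<in> V \<and> V \<subseteq> U"
    using assms unfolding second_countable_def by metis
  have "{U. compact_open X U} \<subseteq> Union ` {\<F>. finite \<F> \<and> \<F> \<subseteq> \<B>}"
  proof
    fix U assume "U \<in> {U. compact_open X U}"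
    then show "U \<in> Union ` {\<F>. finite \<F> \<and> \<F> \<subseteq> \<B>}"
      using compact_open_finite_Union_of_base[of \<B> X U] \<B> by blast
  qed
  moreover have "countable (Union ` {\<F>. finite \<F> \<and> \<F> \<subseteq> \<B>})"
    using \<B>(1) by (intro countable_image countable_Collect_finite_subset)
  ultimately show ?thesis
    by (rule countable_subset)
qed

text \<open>\<open>S\<close> is closed under addition only below \<open>a\<close>, so the group has
  to leave the ray. Let \<open>P\<close> be the monoid of all finite sums from \<open>S\<close>. It
  is closed under non-negative differences, hence \<open>P\<close> together with its negatives is a
  group, and a sum that ends below \<open>a\<close> never leaves \<open>S\<close> on the
  way.\<close>

lemma group_like_of_partial_group:
  fixes S :: "real set"
  assumes sub: "S \<subseteq> real_ray a" and zero: "0 \<in> S"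
    and diff: "\<And>x y. x \<in> S \<Longrightarrow> y \<in> S \<Longrightarrow> x \<le> y \<Longrightarrow> y - x \<in> S"
    and add: "\<And>x y. x \<in> S \<Longrightarrow> y \<in> S \<Longrightarrow> ennreal (x + y) < a \<Longrightarrow> x + y \<in> S"
  shows "\<exists>G. real_additive_subgroup G \<and> S = G \<inter> real_ray a"
proof -
  define P where "P = sum_list ` lists S"
  have nonneg: "0 \<le> x" if "x \<in> S" for x
    using sub that by (auto simp: real_ray_def)
  have P_nonneg: "0 \<le> x" if "x \<in> P" for x
    using that nonneg unfolding P_def by (auto intro!: sum_list_nonneg)
  have P_add: "x + y \<in> P" if "x \<in> P" "y \<in> P" for x y
  proof -
    from that obtain xs ys where "xs \<in> lists S" "x = sum_list xs" "ys \<in> lists S" "y = sum_list ys"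
      unfolding P_def by auto
    then show ?thesis
      unfolding P_def by (intro image_eqI[of _ _ "xs @ ys"]) auto
  qed
  have S_P: "S \<subseteq> P"
  proof
    fix s assume "s \<in> S"
    then show "s \<in> P"
      unfolding P_def by (intro image_eqI[of _ _ "[s]"]) auto
  qed
  have P_0: "0 \<in> P"
    using S_P zero by auto
  \<comment> \<open>All summands are non-negative, so each suffix sum also stays below
    \<open>a\<close> and \<open>add\<close> applies at every stage.\<close>
  have P_ray: "sum_list xs \<in> S" if "xs \<in> lists S" "ennreal (sum_list xs) < a" for xs
    using that
  proof (induction xs rule: list.induct)
    case Nil
    then show ?case using zero by simp
  next
    case (Cons x xs)
    have "x \<in> S" using Cons.prems(1) by simp
    then have "0 \<le> x" by (rule nonneg)
    then have "ennreal (sum_list xs) \<le> ennreal (x + sum_list xs)"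
      by (intro ennreal_leI) simp
    then have "sum_list xs \<in> S"
      using Cons by (simp add: le_less_trans)
    then show ?case
      using Cons.prems add[of x "sum_list xs"] by simp
  qed
  \<comment> \<open>\<open>y\<close> is consumed summand by summand: a summand \<open>x\<close> with
    \<open>y \<le> x\<close> absorbs it entirely, otherwise \<open>x\<close> is dropped and
    \<open>y - x\<close>, again in \<open>S\<close>, remains to be subtracted from the rest.\<close>
  have P_diff_S: "sum_list xs - y \<in> P" if "xs \<in> lists S" "y \<in> S" "y \<le> sum_list xs" for xs y
    using that
  proof (induction xs arbitrary: y rule: list.induct)
    case Nil
    then have "y = 0" using nonneg[of y] by simp
    then show ?case using P_0 by simp
  next
    case (Cons x xs)
    show ?case
    proof (cases "y \<le> x")
      case True
      then have "x - y \<in> P" "sum_list xs \<in> P"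
        using Cons.prems diff S_P unfolding P_def by auto
      from P_add[OF this] show ?thesis by (simp add: algebra_simps)
    next
      case False
      then have "y - x \<in> S" using Cons.prems diff by simp
      then have "sum_list xs - (y - x) \<in> P"
        using Cons by auto
      then show ?thesis by (simp add: algebra_simps)
    qed
  qed
  have P_diff: "x - sum_list ys \<in> P" if "ys \<in> lists S" "x \<in> P" "sum_list ys \<le> x" for x ys
    using that
  proof (induction ys arbitrary: x rule: list.induct)
    case Nil
    then show ?case by simp
  next
    case (Cons y ys)
    have ys: "0 \<le> sum_list ys"
      using Cons.prems nonneg by (auto intro!: sum_list_nonneg)
    obtain xs where "xs \<in> lists S" "x = sum_list xs"
      using Cons.prems unfolding P_def by auto
    then have "x - y \<in> P"
      using P_diff_S[of xs y] Cons.prems ys by simp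
    then have "x - y - sum_list ys \<in> P"
      using Cons by simp
    then show ?case by (simp add: algebra_simps)
  qed
  define G where "G = P \<union> uminus ` P"
  have diff_G: "x - y \<in> G" if "x \<in> P" "y \<in> P" for x y
  proof (cases "y \<le> x")
    case True
    then show ?thesis
      using that P_diff[of _ x] unfolding G_def by (auto simp: P_def)
  next
    case False
    then have "y - x \<in> P"
      using that P_diff[of _ y] False unfolding P_def by fastforce
    then show ?thesis
      unfolding G_def by (intro UnI2 image_eqI[of _ _ "y - x"]) auto
  qed
  have "x + y \<in> G" if x: "x \<in> G" and y: "y \<in> G" for x y
  proof -
    from x y consider "x \<in> P" "y \<in> P" | "x \<in> P" "- y \<in> P" | "- x \<in> P" "y \<in> P" | "- x \<in> P" "- y \<in> P"
      unfolding G_def by auto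
    then show ?thesis
    proof cases
      case 1
      then show ?thesis using P_add unfolding G_def by auto
    next
      case 2
      then show ?thesis using diff_G[of x "- y"] by simp
    next
      case 3
      then show ?thesis using diff_G[of y "- x"] by (simp add: add.commute)
    next
      case 4
      then have "- (x + y) \<in> P" using P_add[of "- x" "- y"] by simp
      then show ?thesis
        unfolding G_def by (intro UnI2 image_eqI[of _ _ "- (x + y)"]) auto
    qed
  qed
  moreover have "0 \<in> G" "\<And>x. x \<in> G \<Longrightarrow> - x \<in> G"
    using P_0 unfolding G_def by auto
  ultimately have "real_additive_subgroup G"
    unfolding real_additive_subgroup_def by blast
  moreover have "S = G \<inter> real_ray a"
  proof
    show "S \<subseteq> G \<inter> real_ray a"
      using S_P sub unfolding G_def by auto
    show "G \<inter> real_ray a \<subseteq> S"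
    proof
      fix x assume x: "x \<in> G \<inter> real_ray a"
      have "x \<in> P"
      proof (cases "x \<in> P")
        case False
        then have "- x \<in> P" using x unfolding G_def by auto
        then have "x = 0" using x P_nonneg[of "- x"] by (simp add: real_ray_def)
        then show ?thesis using P_0 by simp
      qed
      then show "x \<in> S"
        using x P_ray unfolding P_def real_ray_def by auto
    qed
  qed
  ultimately show ?thesis by blast
qed

text \<open>Round \<open>x\<close> down to a multiple of a small element \<open>s\<close>: the error
  is less than \<open>s\<close>, and rounding down cannot leave the ray.\<close>

lemma real_ray_dense_of_small_elements:
  assumes G: "real_additive_subgroup G"
    and small: "\<And>e. e > 0 \<Longrightarrow> \<exists>s \<in> G. 0 < s \<and> s < e"
  shows "real_ray a \<subseteq> closure (G \<inter> real_ray a)"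
proof
  fix x assume x: "x \<in> real_ray a"
  show "x \<in> closure (G \<inter> real_ray a)"
    unfolding closure_approachable
  proof safe
    fix e :: real assume "e > 0"
    then obtain s where s: "s \<in> G" "0 < s" "s < e" using small by blast
    define n where "n = nat \<lfloor>x / s\<rfloor>"
    have x0: "0 \<le> x" using x by (simp add: real_ray_def)
    have "real n * s \<in> G" for n
    proof (induction n)
      case 0
      then show ?case using G by (simp add: real_additive_subgroup_def)
    next
      case (Suc n)
      then show ?case using G s unfolding real_additive_subgroup_def by (auto simp: algebra_simps)
    qed
    moreover have "real n \<le> x / s" "x / s < real n + 1"
      using x0 s unfolding n_def by (auto simp: of_nat_nat; linarith)+
    then have n: "real n * s \<le> x" "x < real n * s + s"
      using s by (auto simp: field_simps)
    moreover have "real n * s \<in> real_ray a"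
      using x n s by (auto simp: real_ray_def intro: le_less_trans[OF ennreal_leI])
    ultimately show "\<exists>y\<in>G \<inter> real_ray a. dist y x < e"
      using s by (intro bexI[of _ "real n * s"]) (auto simp: dist_real_def)
  qed
qed

section \<open>A good measure on a given space: its values and its defective set\<close>

locale good_measure_on_noncompact_Cantor =
  fixes X :: "'a topology" and \<mu> :: "'a measure"
  assumes Cantor: "noncompact_lc_Cantor X" and good: "good_measure X \<mu>"
begin

lemma metrizable: "metrizable_space X" and lc: "locally_compact_space X"
  and noncompact: "\<not> compact_space X"
  using Cantor unfolding noncompact_lc_Cantor_def by - (elim conjE, assumption)+

lemma Hausdorff: "Hausdorff_space X"
  using metrizable by (rule metrizable_imp_Hausdorff_space)

lemma base_compact_open:
  obtains \<B> where "countable \<B>" "\<And>V. V \<in> \<B> \<Longrightarrow> compact_open X V"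
    "\<And>U x. openin X U \<Longrightarrow> x \<in> U \<Longrightarrow> \<exists>V\<in>\<B>. x \<in> V \<and> V \<subseteq> U"
proof -
  from Cantor obtain \<B> where "countable \<B>" "\<forall>V\<in>\<B>. compact_open X V"
    "\<forall>U x. openin X U \<and> x \<in> U \<longrightarrow> (\<exists>V\<in>\<B>. x \<in> V \<and> V \<subseteq> U)"
    unfolding noncompact_lc_Cantor_def by (elim conjE exE) (rule that)
  then show ?thesis by (intro that[of \<B>]) simp_all
qed

lemma second_countable: "second_countable X"
proof -
  obtain \<B> where "countable \<B>" "\<And>V. V \<in> \<B> \<Longrightarrow> compact_open X V"
    "\<And>U x. openin X U \<Longrightarrow> x \<in> U \<Longrightarrow> \<exists>V\<in>\<B>. x \<in> V \<and> V \<subseteq> U"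
    by (rule base_compact_open) (rule that)
  then show ?thesis
    unfolding second_countable_def compact_open_def by (intro exI[of _ \<B>]) auto
qed

lemma dim_le_0: "X dim_le 0"
  unfolding dimension_le_0_neighbourhood_base_of_clopen
proof (subst open_neighbourhood_base_of)
  obtain \<B> where "countable \<B>" and \<B>: "\<And>V. V \<in> \<B> \<Longrightarrow> compact_open X V"
    "\<And>U x. openin X U \<Longrightarrow> x \<in> U \<Longrightarrow> \<exists>V\<in>\<B>. x \<in> V \<and> V \<subseteq> U"
    by (rule base_compact_open) (rule that)
  have "closedin X V \<and> openin X V" if "V \<in> \<B>" for V
    using \<B>(1)[OF that] Hausdorff by (auto simp: compact_open_def compactin_imp_closedin)
  then show "\<forall>W x. openin X W \<and> x \<in> W \<longrightarrow> (\<exists>U. (closedin X U \<and> openin X U) \<and> x \<in> U \<and> U \<subseteq> W)"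
    using \<B>(2) by (intro allI impI) meson
qed auto

lemma sets_openin: "openin X U \<Longrightarrow> U \<in> sets \<mu>"
proof -
  assume U: "openin X U"
  have "{U. openin X U} \<subseteq> Pow (topspace X)" by (auto dest: openin_subset)
  then show ?thesis
    using good U unfolding good_measure_def meas_M0_def meas_M_def borel_measure_on_def by auto
qed

lemma space_eq: "space \<mu> = topspace X"
  using good sets_eq_imp_space_eq[of \<mu> "sigma (topspace X) {U. openin X U}"]
  unfolding good_measure_def meas_M0_def meas_M_def borel_measure_on_def
  by (auto simp: space_measure_of_conv)

lemma sets_compact_open: "compact_open X U \<Longrightarrow> U \<in> sets \<mu>"
  by (simp add: compact_open_def sets_openin)

lemma sets_closedin: "closedin X C \<Longrightarrow> C \<in> sets \<mu>"
  using sets_openin[of "topspace X - C"] space_eq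
  by (metis closedin_def double_diff order_refl sets.compl_sets)

lemma full: "openin X U \<Longrightarrow> U \<noteq> {} \<Longrightarrow> emeasure \<mu> U > 0"
  using good unfolding good_measure_def meas_M0_def meas_M_def full_measure_def by auto

text \<open>The only subsets of a singleton are itself and the empty set, so a singleton of positive
  measure would be an atom.\<close>

lemma emeasure_singleton: "x \<in> topspace X \<Longrightarrow> emeasure \<mu> {x} = 0"
proof (rule ccontr)
  assume x: "x \<in> topspace X" and pos: "emeasure \<mu> {x} \<noteq> 0"
  have "closedin X {x}"
    using Hausdorff x by (simp add: Hausdorff_imp_t1_space closedin_t1_singleton)
  then have "{x} \<in> sets \<mu>" by (rule sets_closedin)
  then have "atom_of \<mu> {x}"
    using pos unfolding atom_of_def by (auto simp: zero_less_iff_neq_zero subset_singleton_iff)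
  then show False
    using good unfolding good_measure_def meas_M0_def meas_M_def non_atomic_def by auto
qed

text \<open>Removes the case distinction on the total mass: for a finite measure all compact open
  sets have finite measure, and they cover the space. As the complement of a union of open sets the
  defective set is visibly closed.\<close>

lemma defective_set_eq:
  "defective_set X \<mu> = topspace X - \<Union>{U. compact_open X U \<and> emeasure \<mu> U < \<infinity>}"
proof (cases "emeasure \<mu> (topspace X) = \<infinity>")
  case True
  then show ?thesis
    unfolding defective_set_def by (auto simp: less_top)
next
  case False
  have "emeasure \<mu> U < \<infinity>" if "compact_open X U" for U
    using False emeasure_space[of \<mu> U] unfolding space_eq by (auto simp: less_top neq_top_trans)
  moreover have "\<exists>U. compact_open X U \<and> x \<in> U" if "x \<in> topspace X" for x
    using Cantor that openin_topspace unfolding noncompact_lc_Cantor_def by metis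
  ultimately show ?thesis
    using False unfolding defective_set_def by (simp add: set_eq_iff) blast
qed

lemma closedin_defective_set: "closedin X (defective_set X \<mu>)"
  unfolding defective_set_eq
  by (intro closedin_diff closedin_topspace openin_Union) (auto simp: compact_open_def)

lemma emeasure_defective_set: "emeasure \<mu> (defective_set X \<mu>) = 0"
  using good unfolding good_measure_def meas_M0_def non_defective_def defective_set_def by auto

text \<open>The countably many compact open sets of finite measure cover everything except the
  defective set, which is null. Their finite unions increase to this complement, so continuity from
  below gives measures close to the total mass.\<close>

lemma exists_large_compact_open:
  assumes "b < emeasure \<mu> (topspace X)"
  obtains U where "compact_open X U" "emeasure \<mu> U < \<infinity>" "b < emeasure \<mu> U"
proof -
  define C where "C = {U. compact_open X U \<and> emeasure \<mu> U < \<infinity>}"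
  have C: "countable C" "C \<noteq> {}"
    using countable_subset[OF _ countable_compact_open[OF second_countable], of C]
    unfolding C_def by (auto intro!: exI[of _ "{}"])
  define W where "W n = (\<Union>i\<le>n. from_nat_into C i)" for n
  have C_co: "compact_open X (from_nat_into C i)" "emeasure \<mu> (from_nat_into C i) < \<infinity>" for i
    using from_nat_into[OF C(2), of i] unfolding C_def by auto
  have W_co: "compact_open X (W n)" for n
    unfolding W_def using C_co by (intro compact_open_UN) auto
  have "emeasure \<mu> (W n) \<le> (\<Sum>i\<le>n. emeasure \<mu> (from_nat_into C i))" for n
    unfolding W_def using C_co sets_compact_open by (intro emeasure_subadditive_finite) auto
  then have W_fin: "emeasure \<mu> (W n) < \<infinity>" for n
    by (rule le_less_trans) (use C_co in auto)
  have "(\<Union>n. W n) = \<Union>C"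
  proof -
    have "(\<Union>n. W n) = (\<Union>n. from_nat_into C n)" unfolding W_def by auto
    also have "\<dots> = \<Union>C" using range_from_nat_into[OF C(2,1)] by simp
    finally show ?thesis .
  qed
  also have "\<dots> = topspace X - defective_set X \<mu>"
    unfolding defective_set_eq C_def
    by (auto simp: compact_open_def dest: openin_subset)
  finally have UN: "(\<Union>n. W n) = topspace X - defective_set X \<mu>" .
  have "(SUP n. emeasure \<mu> (W n)) = emeasure \<mu> (\<Union>n. W n)"
    using W_co sets_compact_open
    by (intro SUP_emeasure_incseq) (auto simp: W_def incseq_def; fastforce)+
  also have "\<dots> = emeasure \<mu> (topspace X)"
    unfolding UN using closedin_defective_set emeasure_defective_set sets_openin
    by (intro emeasure_Diff_null_set) (auto simp: null_sets_def sets_closedin)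
  finally obtain n where "b < emeasure \<mu> (W n)"
    using assms by (metis less_SUP_iff)
  then show ?thesis using that W_co W_fin by blast
qed

text \<open>Finite intersections of basic neighbourhoods of a point \<open>x\<close> decrease to
  \<open>{x}\<close>, which is null, and each of them is open and non-empty, hence of positive
  measure.\<close>

lemma exists_small_compact_open:
  assumes "0 < e"
  obtains U where "compact_open X U" "0 < emeasure \<mu> U" "emeasure \<mu> U < e"
proof -
  have "topspace X \<noteq> {}" using noncompact by (auto simp: compact_space_def)
  then have "0 < emeasure \<mu> (topspace X)" by (simp add: full)
  then obtain U where U: "compact_open X U" "emeasure \<mu> U < \<infinity>" "0 < emeasure \<mu> U"
    using exists_large_compact_open by blast
  then obtain x where x: "x \<in> U" by force
  obtain \<B> where \<B>: "countable \<B>" "\<And>V. V \<in> \<B> \<Longrightarrow> compact_open X V"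
    "\<And>U x. openin X U \<Longrightarrow> x \<in> U \<Longrightarrow> \<exists>V\<in>\<B>. x \<in> V \<and> V \<subseteq> U"
    by (rule base_compact_open) (rule that)
  define Bx where "Bx = {V \<in> \<B>. x \<in> V}"
  have xX: "x \<in> topspace X" using x U(1) by (auto simp: compact_open_def dest: openin_subset)
  have Bx: "countable Bx" "Bx \<noteq> {}"
    using \<B>(1) \<B>(3)[OF openin_topspace xX] unfolding Bx_def by auto
  \<comment> \<open>Intersecting with \<open>U\<close> keeps the measures finite, as continuity from
    above requires.\<close>
  define N where "N n = U \<inter> (\<Inter>i\<le>n. from_nat_into Bx i)" for n
  have N_Suc: "N (Suc n) = N n \<inter> from_nat_into Bx (Suc n)" for n
    unfolding N_def by (auto simp: atMost_Suc)
  have Bx_co: "compact_open X (from_nat_into Bx i)" "x \<in> from_nat_into Bx i" for i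
    using from_nat_into[OF Bx(2), of i] \<B>(2) unfolding Bx_def by auto
  have N_co: "compact_open X (N n)" for n
  proof (induction n)
    case 0
    then show ?case unfolding N_def using U Bx_co Hausdorff by (simp add: compact_open_Int)
  next
    case (Suc n)
    then show ?case unfolding N_Suc using Bx_co Hausdorff by (simp add: compact_open_Int)
  qed
  have "(\<Inter>n. N n) = {x}"
  proof (intro equalityI subsetI)
    fix y assume y: "y \<in> (\<Inter>n. N n)"
    have "y = x"
    proof (rule ccontr)
      assume ne: "y \<noteq> x"
      have "openin X (topspace X - {y})"
        using Hausdorff_imp_t1_space[OF Hausdorff] by (simp add: t1_space_openin_delete_alt)
      then obtain V where V: "V \<in> \<B>" "x \<in> V" "V \<subseteq> topspace X - {y}"
        using \<B>(3) ne xX by blast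
      then obtain i where "from_nat_into Bx i = V"
        using from_nat_into_surj[OF Bx(1), of V] unfolding Bx_def by auto
      then have "y \<in> V" using y unfolding N_def by blast
      then show False using V by auto
    qed
    then show "y \<in> {x}" by simp
  qed (use x Bx_co in \<open>auto simp: N_def\<close>)
  moreover have "(INF n. emeasure \<mu> (N n)) = emeasure \<mu> (\<Inter>n. N n)"
  proof (rule INF_emeasure_decseq)
    show "range N \<subseteq> sets \<mu>" using N_co sets_compact_open by auto
    show "decseq N" unfolding decseq_def N_def by fastforce
    have "emeasure \<mu> (N n) \<le> emeasure \<mu> U" for n
      using U(1) by (intro emeasure_mono) (auto simp: N_def sets_compact_open)
    then show "emeasure \<mu> (N n) \<noteq> \<infinity>" for n
      using U(2) by (metis leD infinity_ennreal_def)
  qed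
  ultimately have "(INF n. emeasure \<mu> (N n)) < e"
    using assms emeasure_singleton[OF xX] by simp
  then obtain n where n: "emeasure \<mu> (N n) < e" by (auto simp: INF_less_iff)
  have "x \<in> N n" unfolding N_def using x Bx_co by auto
  then have "0 < emeasure \<mu> (N n)" using full N_co by (auto simp: compact_open_def)
  with n N_co that show ?thesis by blast
qed

lemma emeasure_compact_open_Diff:
  assumes "compact_open X V" "compact_open X W" "W \<subseteq> V" "emeasure \<mu> V < \<infinity>"
  shows "emeasure \<mu> V = emeasure \<mu> W + emeasure \<mu> (V - W)"
  using plus_emeasure[of W \<mu> "V - W"] assms by (simp add: sets.Diff sets_compact_open Un_absorb1)

lemma compact_open_values_iff:
  "v \<in> compact_open_values X \<mu> \<longleftrightarrow> 0 \<le> v \<and> (\<exists>U. compact_open X U \<and> emeasure \<mu> U = ennreal v)"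
proof
  assume "v \<in> compact_open_values X \<mu>"
  then obtain U where U: "v = measure \<mu> U" "compact_open X U" "emeasure \<mu> U < \<infinity>"
    unfolding compact_open_values_def by blast
  then have "emeasure \<mu> U = ennreal v"
    by (simp add: emeasure_eq_ennreal_measure less_top)
  then show "0 \<le> v \<and> (\<exists>U. compact_open X U \<and> emeasure \<mu> U = ennreal v)"
    using U by auto
next
  assume "0 \<le> v \<and> (\<exists>U. compact_open X U \<and> emeasure \<mu> U = ennreal v)"
  then obtain U where "0 \<le> v" "compact_open X U" "emeasure \<mu> U = ennreal v"
    by blast
  moreover then have "v = measure \<mu> U" by (simp add: measure_def)
  ultimately show "v \<in> compact_open_values X \<mu>"
    unfolding compact_open_values_def by auto
qed

text \<open>The inequality is strict because \<open>X\<close> is not compact: the complement of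
  \<open>U\<close> is open and non-empty, so it carries positive mass.\<close>

lemma compact_open_emeasure_less:
  assumes "compact_open X U" "emeasure \<mu> U < \<infinity>"
  shows "emeasure \<mu> U < emeasure \<mu> (topspace X)"
proof (cases "emeasure \<mu> (topspace X) = \<infinity>")
  case True
  then show ?thesis using assms by simp
next
  case False
  have "closedin X U" "U \<subseteq> topspace X" "U \<noteq> topspace X"
    using assms Hausdorff noncompact
    by (auto simp: compact_open_def compactin_imp_closedin compactin_subset_topspace compact_space_def)
  then have "0 < emeasure \<mu> (topspace X - U)"
    by (intro full) auto
  moreover have "emeasure \<mu> (topspace X) = emeasure \<mu> U + emeasure \<mu> (topspace X - U)"
    using assms \<open>U \<subseteq> topspace X\<close> plus_emeasure[of U \<mu> "topspace X - U"]
      sets_openin[OF openin_diff[OF openin_topspace \<open>closedin X U\<close>]]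
    by (simp add: sets_compact_open Un_absorb1)
  ultimately show ?thesis
    using assms by (metis add.right_neutral ennreal_add_left_cancel_less infinity_ennreal_def less_top)
qed

text \<open>Goodness places a copy \<open>W\<close> of \<open>U\<close> inside \<open>V\<close>; the
  difference is the measure of \<open>V - W\<close>.\<close>

lemma values_diff:
  assumes x: "x \<in> compact_open_values X \<mu>" and y: "y \<in> compact_open_values X \<mu>" and le: "x \<le> y"
  shows "y - x \<in> compact_open_values X \<mu>"
proof -
  obtain U V where UV: "compact_open X U" "emeasure \<mu> U = ennreal x" "0 \<le> x"
    "compact_open X V" "emeasure \<mu> V = ennreal y" "0 \<le> y"
    using x y unfolding compact_open_values_iff by auto
  obtain W where W: "compact_open X W" "W \<subseteq> V" "emeasure \<mu> W = ennreal x"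
  \<comment> \<open>Goodness speaks of strict inequality only; for equal values \<open>V\<close>
    itself serves as \<open>W\<close>.\<close>
  proof (cases "x = y")
    case True
    then show ?thesis using UV that by blast
  next
    case False
    then have "emeasure \<mu> U < emeasure \<mu> V" using UV le by (simp add: ennreal_less_iff)
    then obtain W where "compact_open X W" "W \<subseteq> V" "emeasure \<mu> W = emeasure \<mu> U"
      using good UV unfolding good_measure_def by blast
    then show ?thesis using that UV by simp
  qed
  have "emeasure \<mu> (V - W) = ennreal (y - x)"
    using W UV le emeasure_Diff[of \<mu> W V] by (simp add: sets_compact_open ennreal_minus)
  then show ?thesis
    unfolding compact_open_values_iff using W UV le Hausdorff
    by (auto intro!: exI[of _ "V - W"] compact_open_Diff)
qed

text \<open>\<open>U\<close> and \<open>V\<close> may overlap, so both are copied into a compact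
  open \<open>K\<close> of finite measure larger than \<open>x + y\<close>: first \<open>U\<close>
  to \<open>W\<close> in \<open>K\<close>, then \<open>V\<close> into \<open>K - W\<close>, which
  still has measure larger than \<open>y\<close>.\<close>

lemma values_add:
  assumes x: "x \<in> compact_open_values X \<mu>" and y: "y \<in> compact_open_values X \<mu>"
    and less: "ennreal (x + y) < emeasure \<mu> (topspace X)"
  shows "x + y \<in> compact_open_values X \<mu>"
proof -
  obtain U V where UV: "compact_open X U" "emeasure \<mu> U = ennreal x" "0 \<le> x"
    "compact_open X V" "emeasure \<mu> V = ennreal y" "0 \<le> y"
    using x y unfolding compact_open_values_iff by auto
  obtain K where K: "compact_open X K" "emeasure \<mu> K < \<infinity>" "ennreal (x + y) < emeasure \<mu> K"
    using exists_large_compact_open[OF less] by blast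
  have "emeasure \<mu> U < emeasure \<mu> K"
    using K(3) UV by (metis add_increasing2 ennreal_leI le_less_trans order_refl)
  then obtain W where W: "compact_open X W" "W \<subseteq> K" "emeasure \<mu> W = ennreal x"
    using good UV K unfolding good_measure_def by metis
  have "ennreal x + ennreal y < ennreal x + emeasure \<mu> (K - W)"
    using K W UV emeasure_compact_open_Diff[of K W] by simp
  then have "emeasure \<mu> V < emeasure \<mu> (K - W)"
    using UV by (metis ennreal_add_left_cancel_less)
  moreover have "compact_open X (K - W)"
    using K W Hausdorff by (intro compact_open_Diff)
  ultimately obtain W' where W': "compact_open X W'" "W' \<subseteq> K - W" "emeasure \<mu> W' = ennreal y"
    using good UV unfolding good_measure_def by metis
  have "emeasure \<mu> (W \<union> W') = ennreal (x + y)"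
    using W W' UV plus_emeasure[of W \<mu> W'] by (subst plus_emeasure[symmetric]) (auto simp: sets_compact_open)
  then show ?thesis
    unfolding compact_open_values_iff using W W' UV
    by (auto intro!: exI[of _ "W \<union> W'"] compact_open_Un)
qed

lemma values_group_like:
  "countable_dense_group_like (emeasure \<mu> (topspace X)) (compact_open_values X \<mu>)"
proof -
  let ?S = "compact_open_values X \<mu>"
  have "?S \<subseteq> measure \<mu> ` {U. compact_open X U}"
    unfolding compact_open_values_def by blast
  then have countable: "countable ?S"
    by (rule countable_subset[OF _ countable_image[OF countable_compact_open[OF second_countable]]])
  have sub: "?S \<subseteq> real_ray (emeasure \<mu> (topspace X))"
  proof
    fix v assume "v \<in> ?S"
    then obtain U where "0 \<le> v" "compact_open X U" "emeasure \<mu> U = ennreal v"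
      unfolding compact_open_values_iff by blast
    then show "v \<in> real_ray (emeasure \<mu> (topspace X))"
      using compact_open_emeasure_less[of U] by (simp add: real_ray_def)
  qed
  have "0 \<in> ?S"
    unfolding compact_open_values_iff by (auto intro!: exI[of _ "{}"])
  from group_like_of_partial_group[OF sub this values_diff values_add]
  obtain G where G: "real_additive_subgroup G" "?S = G \<inter> real_ray (emeasure \<mu> (topspace X))"
    by blast
  have "\<exists>s\<in>G. 0 < s \<and> s < e" if e: "e > 0" for e
  proof -
    obtain U where U: "compact_open X U" "0 < emeasure \<mu> U" "emeasure \<mu> U < ennreal e"
    proof (rule exists_small_compact_open)
      show "0 < ennreal e" using e by simp
    qed
    then have "emeasure \<mu> U < \<top>"
      using ennreal_less_top less_trans by blast
    then have eq: "emeasure \<mu> U = ennreal (measure \<mu> U)"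
      by (simp add: emeasure_eq_ennreal_measure)
    then have "measure \<mu> U \<in> ?S"
      using U(1) unfolding compact_open_values_iff by (metis measure_nonneg)
    moreover have "0 < measure \<mu> U" "measure \<mu> U < e"
      using U(2,3) unfolding eq by (simp_all add: ennreal_less_iff)
    ultimately show ?thesis using G by auto
  qed
  then show ?thesis
    unfolding countable_dense_group_like_def
    using countable sub G real_ray_dense_of_small_elements[OF G(1)] by auto
qed

lemma defective_set_lc_zero_dim:
  "lc_zero_dim_metric_space (subtopology X (defective_set X \<mu>))"
  unfolding lc_zero_dim_metric_space_def
  by (intro conjI metrizable_space_subtopology metrizable second_countable_subtopology second_countable
      locally_compact_space_closed_subset lc closedin_defective_set dimension_le_subtopology dim_le_0)

end

section \<open>The Stone space of a ring of measurable sets\<close>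

abbreviation cantor_topology :: "(nat \<Rightarrow> bool) topology" where
  "cantor_topology \<equiv> product_topology (\<lambda>_. discrete_topology UNIV) UNIV"

definition agreeing :: "nat set \<Rightarrow> (nat \<Rightarrow> bool) \<Rightarrow> (nat \<Rightarrow> bool) set" where
  "agreeing F f = {g. \<forall>n\<in>F. g n = f n}"

text \<open>The factors are discrete, so a box around \<open>f\<close> contains the box that fixes
  its finitely many restricted coordinates to their values at \<open>f\<close>; the sets
  \<open>agreeing F f\<close> with \<open>F\<close> finite form a neighbourhood base.\<close>

lemma openin_cantor_topology:
  "openin cantor_topology T \<longleftrightarrow> (\<forall>f\<in>T. \<exists>F. finite F \<and> agreeing F f \<subseteq> T)"
proof
  assume T: "openin cantor_topology T"
  show "\<forall>f\<in>T. \<exists>F. finite F \<and> agreeing F f \<subseteq> T"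
  proof
    fix f assume "f \<in> T"
    then obtain U where U: "finite {i. U i \<noteq> (UNIV::bool set)}" "f \<in> Pi\<^sub>E UNIV U" "Pi\<^sub>E UNIV U \<subseteq> T"
      using T unfolding openin_product_topology_alt by auto
    have "agreeing {i. U i \<noteq> UNIV} f \<subseteq> T"
    proof
      fix g assume g: "g \<in> agreeing {i. U i \<noteq> UNIV} f"
      have "g n \<in> U n" for n
        using g U(2) by (cases "U n = UNIV") (auto simp: agreeing_def PiE_iff)
      then show "g \<in> T" using U(3) by (auto simp: PiE_iff)
    qed
    then show "\<exists>F. finite F \<and> agreeing F f \<subseteq> T"
      using U(1) by blast
  qed
next
  assume *: "\<forall>f\<in>T. \<exists>F. finite F \<and> agreeing F f \<subseteq> T"
  show "openin cantor_topology T"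
    unfolding openin_product_topology_alt
  proof
    fix f assume "f \<in> T"
    then obtain F where F: "finite F" "agreeing F f \<subseteq> T"
      using * by blast
    define U where "U n = (if n \<in> F then {f n} else UNIV)" for n
    have "finite {i. U i \<noteq> UNIV}"
      using F(1) by (rule finite_subset[rotated]) (auto simp: U_def)
    moreover have "Pi\<^sub>E UNIV U \<subseteq> agreeing F f"
    proof
      fix g assume g: "g \<in> Pi\<^sub>E UNIV U"
      have "g n = f n" if "n \<in> F" for n
        using PiE_mem[OF g, of n] that by (simp add: U_def)
      then show "g \<in> agreeing F f" by (simp add: agreeing_def)
    qed
    moreover have "f \<in> Pi\<^sub>E UNIV U"
      by (simp add: U_def PiE_iff)
    ultimately show "\<exists>U. finite {i \<in> UNIV. U i \<noteq> topspace (discrete_topology (UNIV::bool set))} \<and>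
        (\<forall>i\<in>UNIV. openin (discrete_topology UNIV) (U i)) \<and> f \<in> Pi\<^sub>E UNIV U \<and> Pi\<^sub>E UNIV U \<subseteq> T"
      using F(2) by (intro exI[of _ U]) simp
  qed
qed

lemma agreeing_refl: "f \<in> agreeing F f"
  by (simp add: agreeing_def)

lemma openin_agreeing: "finite F \<Longrightarrow> openin cantor_topology (agreeing F f)"
  unfolding openin_cantor_topology by (intro ballI exI[of _ F]) (simp add: agreeing_def)

lemma in_closure_of_cantor_topology:
  "f \<in> cantor_topology closure_of S \<longleftrightarrow> (\<forall>F. finite F \<longrightarrow> S \<inter> agreeing F f \<noteq> {})"
proof
  assume f: "f \<in> cantor_topology closure_of S"
  show "\<forall>F. finite F \<longrightarrow> S \<inter> agreeing F f \<noteq> {}"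
    using f openin_agreeing agreeing_refl unfolding in_closure_of by (metis disjoint_iff)
next
  assume S: "\<forall>F. finite F \<longrightarrow> S \<inter> agreeing F f \<noteq> {}"
  have "\<exists>g. g \<in> S \<and> g \<in> T" if "f \<in> T" and T: "openin cantor_topology T" for T
  proof -
    obtain F where "finite F" and F: "agreeing F f \<subseteq> T"
      using T \<open>f \<in> T\<close> unfolding openin_cantor_topology by blast
    then have "S \<inter> agreeing F f \<noteq> {}" using S by blast
    then show ?thesis using F by blast
  qed
  then show "f \<in> cantor_topology closure_of S"
    unfolding in_closure_of by simp
qed

lemma clopen_cantor_coordinate:
  "openin cantor_topology {f. f n}" "closedin cantor_topology {f. f n}"
proof -
  show "openin cantor_topology {f. f n}"
    unfolding openin_cantor_topology by (intro ballI exI[of _ "{n}"]) (auto simp: agreeing_def)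
  have "openin cantor_topology {f. \<not> f n}"
    unfolding openin_cantor_topology by (intro ballI exI[of _ "{n}"]) (auto simp: agreeing_def)
  moreover have "UNIV - {f. f n} = {f. \<not> f n}" by auto
  ultimately show "closedin cantor_topology {f. f n}"
    by (simp add: closedin_def)
qed

text \<open>In \<open>small_cover\<close> the bound \<open>e\<close> is arbitrary: it yields \<open>\<sigma>\<close>-finiteness for \<open>e = 1\<close> and
  non-atomicity for small \<open>e\<close>.\<close>

locale measure_ring =
  fixes M :: "'a measure" and R :: "'a set set"
  assumes ring: "ring_of_sets (space M) R"
    and ring_sets: "R \<subseteq> sets M"
    and countable_ring: "countable R"
    and ring_pos: "\<And>s. s \<in> R \<Longrightarrow> s \<noteq> {} \<Longrightarrow> 0 < emeasure M s"
    and small_cover: "\<And>x e. x \<in> space M \<Longrightarrow> 0 < e \<Longrightarrow> \<exists>s\<in>R. x \<in> s \<and> emeasure M s \<le> e"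
    and ring_good: "\<And>s t. s \<in> R \<Longrightarrow> t \<in> R \<Longrightarrow> emeasure M s < emeasure M t \<Longrightarrow>
      \<exists>w\<in>R. w \<subseteq> t \<and> emeasure M w = emeasure M s"
    and space_notin_ring: "space M \<notin> R"
    and total_mass: "emeasure M (space M) = 1 \<or> emeasure M (space M) = \<infinity>"
begin

section \<open>Coding points by ring membership; topology and measure of the Stone space\<close>

sublocale ring_of_sets "space M" R
  by (rule ring)

definition r :: "nat \<Rightarrow> 'a set" where
  "r = from_nat_into R"

definition code :: "'a \<Rightarrow> nat \<Rightarrow> bool" where
  "code x n \<longleftrightarrow> x \<in> r n"

text \<open>The points are the truth assignments on \<open>R\<close> that are finitely consistent
  with actual points of \<open>space M\<close>, that is, the ultrafilters of \<open>R\<close>. The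
  zero sequence contains no ring element and plays the part of the point at infinity.\<close>

definition stone :: "(nat \<Rightarrow> bool) topology" where
  "stone = subtopology cantor_topology (cantor_topology closure_of (code ` space M) - {\<lambda>_. False})"

definition stone_measure :: "(nat \<Rightarrow> bool) measure" where
  "stone_measure = distr M (sigma (topspace stone) {U. openin stone U}) code"

definition cyl :: "nat \<Rightarrow> (nat \<Rightarrow> bool) set" where
  "cyl n = {f \<in> topspace stone. f n}"

lemma r_in [simp]: "r n \<in> R"
  unfolding r_def by (intro from_nat_into) auto

lemma r_surj: "s \<in> R \<Longrightarrow> \<exists>n. r n = s"
  unfolding r_def using countable_ring by (rule from_nat_into_surj)

lemma r_subset: "r n \<subseteq> space M"
  using r_in sets_into_space by blast

lemma topspace_stone:
  "topspace stone = {f. f \<noteq> (\<lambda>_. False) \<and> (\<forall>F. finite F \<longrightarrow> code ` space M \<inter> agreeing F f \<noteq> {})}"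
proof -
  have "topspace stone = cantor_topology closure_of (code ` space M) - {\<lambda>_. False}"
    unfolding stone_def topspace_subtopology by simp
  also have "\<dots> = {f. f \<noteq> (\<lambda>_. False) \<and> f \<in> cantor_topology closure_of (code ` space M)}"
    by auto
  finally show ?thesis unfolding in_closure_of_cantor_topology .
qed

text \<open>The transfer tool: on finitely many coordinates a point of \<open>stone\<close> looks
  like a point of \<open>space M\<close>, so every Boolean relation among finitely many
  \<open>r n\<close> carries over to the coordinates of \<open>f\<close>.\<close>

lemma stone_approx:
  assumes "f \<in> topspace stone" "finite F"
  shows "\<exists>x\<in>space M. \<forall>n\<in>F. x \<in> r n \<longleftrightarrow> f n"
proof -
  have "code ` space M \<inter> agreeing F f \<noteq> {}"
    using assms unfolding topspace_stone by simp
  then obtain x where "x \<in> space M" "code x \<in> agreeing F f" by blast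
  then show ?thesis by (intro bexI[of _ x]) (simp_all add: agreeing_def code_def)
qed

lemma stone_nonzero:
  assumes "f \<in> topspace stone"
  shows "\<exists>n. f n"
proof (rule ccontr)
  assume "\<nexists>n. f n"
  then have "f = (\<lambda>_. False)" by auto
  then show False using assms unfolding topspace_stone by simp
qed

text \<open>\<open>small_cover\<close> puts \<open>x\<close> into some ring element, so its code is
  not the zero sequence.\<close>

lemma code_in_stone: "x \<in> space M \<Longrightarrow> code x \<in> topspace stone"
proof -
  assume x: "x \<in> space M"
  then obtain s where "s \<in> R" "x \<in> s" using small_cover[of x 1] by auto
  then obtain n where "x \<in> r n" using r_surj by blast
  then show ?thesis
    unfolding topspace_stone mem_Collect_eq using x agreeing_refl[of "code x"]
    by (auto simp: code_def dest: fun_cong)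
qed

text \<open>One direction transfers the inclusion by \<open>stone_approx\<close>; for the other the
  codes of points of \<open>space M\<close> serve as test points.\<close>

lemma cyl_mono_iff: "cyl n \<subseteq> cyl m \<longleftrightarrow> r n \<subseteq> r m"
proof
  assume "r n \<subseteq> r m"
  show "cyl n \<subseteq> cyl m"
  proof
    fix f assume f: "f \<in> cyl n"
    then obtain x where "x \<in> r n \<longleftrightarrow> f n" "x \<in> r m \<longleftrightarrow> f m"
      using stone_approx[of f "{n, m}"] unfolding cyl_def by auto
    then show "f \<in> cyl m"
      using f \<open>r n \<subseteq> r m\<close> unfolding cyl_def by auto
  qed
next
  assume le: "cyl n \<subseteq> cyl m"
  show "r n \<subseteq> r m"
  proof
    fix x assume x: "x \<in> r n"
    then have "x \<in> space M" using r_subset by blast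
    then have "code x \<in> topspace stone" by (rule code_in_stone)
    then show "x \<in> r m"
      using le x unfolding cyl_def by (auto simp: code_def)
  qed
qed

lemma cyl_Un: "r k = r n \<union> r m \<Longrightarrow> cyl k = cyl n \<union> cyl m"
proof
  assume k: "r k = r n \<union> r m"
  then show "cyl n \<union> cyl m \<subseteq> cyl k"
    by (simp add: cyl_mono_iff)
  show "cyl k \<subseteq> cyl n \<union> cyl m"
  proof
    fix f assume f: "f \<in> cyl k"
    then obtain x where "x \<in> r n \<longleftrightarrow> f n" "x \<in> r m \<longleftrightarrow> f m" "x \<in> r k \<longleftrightarrow> f k"
      using stone_approx[of f "{n, m, k}"] unfolding cyl_def by auto
    then show "f \<in> cyl n \<union> cyl m"
      using f k unfolding cyl_def by auto
  qed
qed

lemma cyl_eq_empty_iff: "cyl n = {} \<longleftrightarrow> r n = {}"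
proof -
  obtain k where k: "r k = {}" using r_surj by blast
  have "f \<notin> cyl k" for f
    using stone_approx[of f "{k}"] k unfolding cyl_def by auto
  then have "cyl k = {}" by blast
  then show ?thesis using cyl_mono_iff[of n k] k by auto
qed

lemma code_vimage_cyl: "code -` cyl n \<inter> space M = r n"
  using r_subset code_in_stone by (auto simp: cyl_def code_def)

text \<open>\<open>R\<close> has no complements, so negative conditions make sense only relative to
  a ring element \<open>s\<close>.\<close>

lemma ring_pattern:
  assumes "finite F" "s \<in> R"
  shows "{x \<in> s. \<forall>n\<in>F. x \<in> r n \<longleftrightarrow> f n} \<in> R"
  using assms(1)
proof (induction F rule: finite_induct)
  case empty
  then show ?case using assms by simp
next
  case (insert m F)
  let ?t = "{x \<in> s. \<forall>n\<in>F. x \<in> r n \<longleftrightarrow> f n}"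
  have "{x \<in> s. \<forall>n\<in>insert m F. x \<in> r n \<longleftrightarrow> f n} = (if f m then ?t - (?t - r m) else ?t - r m)"
    by auto
  then show ?case using insert.IH by (simp add: Diff)
qed

text \<open>A basic neighbourhood prescribes finitely many coordinates, possibly to be false. Since
  \<open>f\<close> is not zero, some \<open>f m\<close> holds, and inside \<open>r m\<close> the
  whole pattern is a single ring element \<open>r k\<close>; its cylinder is the required
  one.\<close>

lemma cyl_base:
  assumes U: "openin stone U" and f: "f \<in> U"
  shows "\<exists>n. f \<in> cyl n \<and> cyl n \<subseteq> U"
proof -
  obtain T where T: "openin cantor_topology T" "U = T \<inter> topspace stone"
    using U by (auto simp: stone_def openin_subtopology)
  obtain F where F: "finite F" "agreeing F f \<subseteq> T"
    using T f unfolding openin_cantor_topology by blast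
  have ft: "f \<in> topspace stone" using f T by simp
  then obtain m where m: "f m" using stone_nonzero by blast
  obtain k where k: "r k = {x \<in> r m. \<forall>n\<in>F. x \<in> r n \<longleftrightarrow> f n}"
    using ring_pattern[OF F(1) r_in, of m f] r_surj by blast
  have fin: "finite (insert m (insert k F))" using F by simp
  have "f \<in> cyl k"
    using stone_approx[OF ft fin] ft m k unfolding cyl_def by auto
  moreover have "cyl k \<subseteq> U"
  proof
    fix g assume g: "g \<in> cyl k"
    then have gt: "g \<in> topspace stone" "g k" by (auto simp: cyl_def)
    obtain x where x: "\<forall>n\<in>insert m (insert k F). x \<in> r n \<longleftrightarrow> g n"
      using stone_approx[OF gt(1) fin] by blast
    then have "x \<in> r k" using gt by simp
    then have "g \<in> agreeing F f" using x k unfolding agreeing_def by auto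
    then show "g \<in> U" using F(2) gt T by auto
  qed
  ultimately show ?thesis by blast
qed

text \<open>The condition \<open>f n\<close> already excludes the zero sequence, so removing that
  point does not affect the cylinder: it is closed in the compact Cantor space.\<close>

lemma compact_open_cyl: "compact_open stone (cyl n)"
proof -
  let ?K = "cantor_topology closure_of (code ` space M)"
  have cyl: "cyl n = {f. f n} \<inter> topspace stone" by (auto simp: cyl_def)
  have cyl': "cyl n = {f. f n} \<inter> ?K" unfolding cyl_def stone_def by auto
  have "closedin cantor_topology (cyl n)"
    unfolding cyl' by (intro closedin_Int clopen_cantor_coordinate closedin_closure_of)
  moreover have "compact_space cantor_topology"
    unfolding compact_space_product_topology by (simp add: compact_space_discrete_topology)
  ultimately have "compactin cantor_topology (cyl n)"
    by (intro closedin_compact_space)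
  moreover have "cyl n \<subseteq> ?K - {\<lambda>_. False}"
    unfolding cyl' by auto
  ultimately have "compactin stone (cyl n)"
    unfolding stone_def by (simp add: compactin_subtopology)
  moreover have "openin stone (cyl n)"
    unfolding cyl unfolding stone_def
    by (auto simp: openin_subtopology intro!: exI[of _ "{f. f n}"] clopen_cantor_coordinate)
  ultimately show ?thesis by (simp add: compact_open_def)
qed

text \<open>Compactness reduces \<open>U\<close> to a finite union of cylinders, and this is one
  cylinder because \<open>R\<close> is closed under unions.\<close>

lemma compact_open_stone_iff: "compact_open stone U \<longleftrightarrow> (\<exists>n. U = cyl n)"
proof
  assume U: "compact_open stone U"
  obtain \<F> where \<F>: "finite \<F>" "\<F> \<subseteq> range cyl" "U = \<Union>\<F>"
  proof (rule compact_open_finite_Union_of_base[OF _ _ U])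
    show "openin stone V" if "V \<in> range cyl" for V
      using that compact_open_cyl by (auto simp: compact_open_def)
    show "\<exists>V\<in>range cyl. f \<in> V \<and> V \<subseteq> W" if "openin stone W" "f \<in> W" for W f
      using cyl_base[OF that] by auto
  qed
  from \<F>(1,2) have "\<exists>n. \<Union>\<F> = cyl n"
  proof (induction \<F> rule: finite_induct)
    case empty
    obtain k where "r k = {}" using r_surj by blast
    then show ?case using cyl_eq_empty_iff by auto
  next
    case (insert V \<F>)
    then obtain n m where "V = cyl n" "\<Union>\<F> = cyl m" by auto
    moreover obtain k where "r k = r n \<union> r m"
      using r_surj[OF Un[OF r_in r_in]] by blast
    ultimately show ?case using cyl_Un by (intro exI[of _ k]) simp
  qed
  then show "\<exists>n. U = cyl n" using \<F> by simp
qed (use compact_open_cyl in auto)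

lemma sets_stone_measure: "sets stone_measure = sets (sigma (topspace stone) {U. openin stone U})"
  by (simp add: stone_measure_def)

lemma space_stone_measure: "space stone_measure = topspace stone"
  by (simp add: stone_measure_def space_measure_of_conv)

text \<open>An open set is the countable union of the cylinders it contains, and their preimages are
  ring elements.\<close>

lemma measurable_code:
  "code \<in> measurable M (sigma (topspace stone) {U. openin stone U})"
proof (rule measurable_measure_of)
  show "{U. openin stone U} \<subseteq> Pow (topspace stone)" by (auto dest: openin_subset)
  show "code \<in> space M \<rightarrow> topspace stone" using code_in_stone by auto
  fix U assume "U \<in> {U. openin stone U}"
  then have U: "openin stone U" by simp
  have "code -` U \<inter> space M = (\<Union>n\<in>{n. cyl n \<subseteq> U}. code -` cyl n \<inter> space M)"
    using cyl_base[OF U] by blast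
  also have "\<dots> = (\<Union>n\<in>{n. cyl n \<subseteq> U}. r n)"
    by (simp only: code_vimage_cyl)
  also have "\<dots> \<in> sets M"
    using ring_sets by (intro sets.countable_UN') auto
  finally show "code -` U \<inter> space M \<in> sets M" .
qed

lemma sets_stone_openin: "openin stone U \<Longrightarrow> U \<in> sets stone_measure"
proof -
  assume U: "openin stone U"
  have "{U. openin stone U} \<subseteq> Pow (topspace stone)" by (auto dest: openin_subset)
  then show ?thesis
    using U unfolding sets_stone_measure by auto
qed

lemma emeasure_stone:
  "E \<in> sets stone_measure \<Longrightarrow> emeasure stone_measure E = emeasure M (code -` E \<inter> space M)"
  unfolding sets_stone_measure unfolding stone_measure_def
  by (intro emeasure_distr measurable_code) simp

lemma sets_cyl: "cyl n \<in> sets stone_measure"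
  using compact_open_cyl by (auto simp: compact_open_def intro: sets_stone_openin)

lemma emeasure_cyl: "emeasure stone_measure (cyl n) = emeasure M (r n)"
  by (simp only: emeasure_stone sets_cyl code_vimage_cyl)

lemma emeasure_topspace_stone: "emeasure stone_measure (topspace stone) = emeasure M (space M)"
proof -
  have "code -` topspace stone \<inter> space M = space M" using code_in_stone by auto
  then show ?thesis by (simp add: emeasure_stone sets_stone_openin)
qed

lemma full_stone: "full_measure stone stone_measure"
  unfolding full_measure_def
proof (intro allI impI)
  fix U assume "openin stone U \<and> U \<noteq> {}"
  then obtain f where U: "openin stone U" "f \<in> U" by auto
  then obtain n where n: "f \<in> cyl n" "cyl n \<subseteq> U" using cyl_base by blast
  then have "0 < emeasure stone_measure (cyl n)"
    using cyl_eq_empty_iff[of n] by (auto simp: emeasure_cyl intro: ring_pos)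
  also have "\<dots> \<le> emeasure stone_measure U"
    using n U by (intro emeasure_mono sets_stone_openin) auto
  finally show "0 < emeasure stone_measure U" .
qed

text \<open>Let \<open>e\<close> be below the mass of an atom \<open>E\<close>. Every cylinder of
  mass at most \<open>e\<close> meets \<open>E\<close> in a set of smaller mass, hence in a null
  set. By \<open>small_cover\<close> countably many such cylinders cover all codes, so
  \<open>E\<close> would be null.\<close>

lemma non_atomic_stone: "non_atomic stone_measure"
  unfolding non_atomic_def
proof
  assume "\<exists>E. atom_of stone_measure E"
  then obtain E where E: "E \<in> sets stone_measure" "0 < emeasure stone_measure E"
    "\<And>B. B \<in> sets stone_measure \<Longrightarrow> B \<subseteq> E \<Longrightarrow> emeasure stone_measure B < emeasure stone_measure E
      \<Longrightarrow> emeasure stone_measure B = 0"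
    unfolding atom_of_def by blast
  obtain e where e: "0 < e" "e < emeasure stone_measure E"
    using dense[OF E(2)] by blast
  define A where "A n = code -` (E \<inter> cyl n) \<inter> space M" for n
  have A: "A n \<in> sets M" for n
  proof -
    have "E \<inter> cyl n \<in> sets (sigma (topspace stone) {U. openin stone U})"
      using E(1) sets_cyl unfolding sets_stone_measure[symmetric] by blast
    then show ?thesis unfolding A_def by (rule measurable_sets[OF measurable_code])
  qed
  have "A n \<in> null_sets M" if "emeasure M (r n) \<le> e" for n
  proof -
    have "emeasure stone_measure (E \<inter> cyl n) \<le> emeasure stone_measure (cyl n)"
      using sets_cyl by (intro emeasure_mono) auto
    then have "emeasure stone_measure (E \<inter> cyl n) < emeasure stone_measure E"
      using that e by (simp add: emeasure_cyl)
    then have "emeasure stone_measure (E \<inter> cyl n) = 0"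
      using E(1) sets_cyl by (intro E(3)) auto
    then have "emeasure M (A n) = 0"
      using E(1) sets_cyl unfolding A_def by (subst emeasure_stone[symmetric]) auto
    then show ?thesis using A by auto
  qed
  then have null: "(\<Union>n\<in>{n. emeasure M (r n) \<le> e}. A n) \<in> null_sets M"
    by (intro null_sets_UN') auto
  have "code -` E \<inter> space M \<subseteq> (\<Union>n\<in>{n. emeasure M (r n) \<le> e}. A n)"
  proof
    fix x assume x: "x \<in> code -` E \<inter> space M"
    then obtain s where "s \<in> R" "x \<in> s" "emeasure M s \<le> e"
      using small_cover[of x e] e by auto
    then obtain n where "x \<in> r n" "emeasure M (r n) \<le> e"
      using r_surj by blast
    moreover then have "code x \<in> cyl n"
      using code_vimage_cyl[of n] by blast
    ultimately show "x \<in> (\<Union>n\<in>{n. emeasure M (r n) \<le> e}. A n)"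
      using x unfolding A_def by blast
  qed
  then have "emeasure M (code -` E \<inter> space M) \<le> 0"
    using emeasure_mono[of _ _ M] null by (metis null_setsD1 null_setsD2)
  then show False
    using E(1,2) by (simp add: emeasure_stone)
qed

lemma noncompact_lc_Cantor_stone: "noncompact_lc_Cantor stone"
  unfolding noncompact_lc_Cantor_def
proof (intro conjI ballI exI[of _ "range cyl"] allI impI)
  show "\<not> compact_space stone"
  proof
    \<comment> \<open>If the whole space were compact it would be a cylinder \<open>cyl n\<close>,
      and pulling back along \<open>code\<close> would make \<open>space M\<close> the ring element
      \<open>r n\<close>.\<close>
    assume "compact_space stone"
    then have "compact_open stone (topspace stone)"
      by (simp add: compact_open_def compact_space_def)
    then obtain n where n: "topspace stone = cyl n"
      using compact_open_stone_iff by blast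
    have "r n = code -` topspace stone \<inter> space M"
      unfolding n code_vimage_cyl ..
    also have "\<dots> = space M" using code_in_stone by auto
    finally show False using space_notin_ring r_in by metis
  qed
  show "metrizable_space stone"
    unfolding stone_def by (intro metrizable_space_subtopology) (simp add: metrizable_space_product_topology)
  show "locally_compact_space stone"
    unfolding locally_compact_space_def
  proof
    fix f assume f: "f \<in> topspace stone"
    then obtain n where "f n" using stone_nonzero by blast
    then have "f \<in> cyl n" using f by (simp add: cyl_def)
    then show "\<exists>U K. openin stone U \<and> compactin stone K \<and> f \<in> U \<and> U \<subseteq> K"
      using compact_open_cyl[of n] unfolding compact_open_def by blast
  qed
  \<comment> \<open>An open singleton has positive measure by fullness and would then be an
    atom.\<close>
  show "\<not> openin stone {f}" if "f \<in> topspace stone" for f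
  proof
    assume o: "openin stone {f}"
    then have "0 < emeasure stone_measure {f}"
      using full_stone unfolding full_measure_def by blast
    then have "atom_of stone_measure {f}"
      unfolding atom_of_def using sets_stone_openin[OF o] by (auto simp: subset_singleton_iff)
    then show False using non_atomic_stone by (simp add: non_atomic_def)
  qed
  show "countable (range cyl)" by simp
  show "compact_open stone V" if "V \<in> range cyl" for V
    using that compact_open_cyl by auto
  show "\<exists>V\<in>range cyl. f \<in> V \<and> V \<subseteq> U" if "openin stone U \<and> f \<in> U" for U f
    using cyl_base that by auto
qed

lemma defective_set_stone:
  "defective_set stone stone_measure =
     (if emeasure M (space M) = \<infinity>
      then {f \<in> topspace stone. \<forall>n. f n \<longrightarrow> emeasure M (r n) = \<infinity>} else {})"
proof -
  have "(\<forall>U. compact_open stone U \<and> f \<in> U \<longrightarrow> emeasure stone_measure U = \<infinity>)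
      \<longleftrightarrow> (\<forall>n. f n \<longrightarrow> emeasure M (r n) = \<infinity>)" if "f \<in> topspace stone" for f
  proof -
    have "(\<forall>U. compact_open stone U \<and> f \<in> U \<longrightarrow> emeasure stone_measure U = \<infinity>)
      \<longleftrightarrow> (\<forall>n. f \<in> cyl n \<longrightarrow> emeasure stone_measure (cyl n) = \<infinity>)"
      unfolding compact_open_stone_iff by blast
    also have "\<dots> \<longleftrightarrow> (\<forall>n. f n \<longrightarrow> emeasure M (r n) = \<infinity>)"
      unfolding emeasure_cyl using that by (simp add: cyl_def)
    finally show ?thesis .
  qed
  then show ?thesis
    unfolding defective_set_def emeasure_topspace_stone by auto
qed

text \<open>By \<open>small_cover\<close> each code lies in a cylinder of measure at most 1, so no
  code is defective and the preimage of the defective set is empty.\<close>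

lemma non_defective_stone:
  assumes "emeasure M (space M) = \<infinity>"
  shows "non_defective stone stone_measure"
  unfolding non_defective_def
proof
  show "emeasure stone_measure (topspace stone) = \<infinity>"
    using assms by (simp add: emeasure_topspace_stone)
  let ?D = "defective_set stone stone_measure"
  have "code x \<notin> ?D" if x: "x \<in> space M" for x
  proof -
    obtain s where "s \<in> R" "x \<in> s" "emeasure M s \<le> 1"
      using small_cover[OF x, of 1] by auto
    then obtain n where "x \<in> r n" "emeasure M (r n) \<le> 1" using r_surj by blast
    then have "code x n" "emeasure M (r n) \<noteq> \<infinity>"
      by (auto simp: code_def dest: neq_top_trans[rotated])
    then show ?thesis unfolding defective_set_stone by auto
  qed
  then have empty: "code -` ?D \<inter> space M = {}" by auto
  show "emeasure stone_measure ?D = 0"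
  \<comment> \<open>Outside \<open>sets\<close> the value of \<open>emeasure\<close> is 0 by
    default, so both cases yield 0.\<close>
  proof (cases "?D \<in> sets stone_measure")
    case True
    then show ?thesis by (simp add: emeasure_stone empty)
  qed (simp add: emeasure_notin_sets)
qed

lemma good_stone: "good_measure stone stone_measure"
  unfolding good_measure_def
proof (intro conjI allI impI)
  show "stone_measure \<in> meas_M0 stone"
    unfolding meas_M0_def meas_M_def borel_measure_on_def
    using full_stone non_atomic_stone sets_stone_measure total_mass non_defective_stone
    by (auto simp: emeasure_topspace_stone)
  fix U V
  assume "compact_open stone U \<and> compact_open stone V \<and> emeasure stone_measure U < emeasure stone_measure V"
  then obtain n m where "U = cyl n" "V = cyl m" and less: "emeasure M (r n) < emeasure M (r m)"
    unfolding compact_open_stone_iff by (auto simp: emeasure_cyl)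
  moreover obtain w where "w \<in> R" "w \<subseteq> r m" "emeasure M w = emeasure M (r n)"
    using ring_good[OF r_in r_in less] by blast
  moreover then obtain k where "r k = w" using r_surj by blast
  ultimately show "\<exists>W. compact_open stone W \<and> W \<subseteq> V \<and> emeasure stone_measure W = emeasure stone_measure U"
    by (intro exI[of _ "cyl k"]) (auto simp: compact_open_cyl cyl_mono_iff emeasure_cyl)
qed

lemma compact_open_values_stone:
  "compact_open_values stone stone_measure = {measure M s | s. s \<in> R \<and> emeasure M s < \<infinity>}"
proof -
  have *: "measure stone_measure (cyl n) = measure M (r n)" for n
    by (simp add: measure_def emeasure_cyl)
  have "v \<in> compact_open_values stone stone_measure
      \<longleftrightarrow> (\<exists>n. v = measure M (r n) \<and> emeasure M (r n) < \<infinity>)" for v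
  proof -
    have "v \<in> compact_open_values stone stone_measure
      \<longleftrightarrow> (\<exists>n. v = measure stone_measure (cyl n) \<and> emeasure stone_measure (cyl n) < \<infinity>)"
      unfolding compact_open_values_def compact_open_stone_iff by blast
    then show ?thesis unfolding * emeasure_cyl .
  qed
  then show ?thesis
    using r_surj r_in by blast
qed

end

section \<open>Rings of half-open intervals\<close>

lemma real_additive_subgroup_add:
  assumes "real_additive_subgroup G" "x \<in> G" "y \<in> G"
  shows "x + y \<in> G"
  by (rule assms(1)[unfolded real_additive_subgroup_def, THEN conjunct2, THEN conjunct1,
        rule_format, OF assms(2,3)])

lemma real_additive_subgroup_diff:
  assumes "real_additive_subgroup G" "x \<in> G" "y \<in> G"
  shows "x - y \<in> G"
proof -
  have "- y \<in> G"
    by (rule assms(1)[unfolded real_additive_subgroup_def, THEN conjunct2, THEN conjunct2,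
          rule_format, OF assms(3)])
  from real_additive_subgroup_add[OF assms(1,2) this] show ?thesis by simp
qed

locale group_like_values =
  fixes a :: ennreal and D :: "real set"
  assumes group_like: "countable_dense_group_like a D"
    and a_cases: "a = 1 \<or> a = \<infinity>"
begin

lemma countable_D: "countable D"
  and D_ray: "D \<subseteq> real_ray a"
  and dense_D: "real_ray a \<subseteq> closure D"
  using group_like unfolding countable_dense_group_like_def by - (elim conjE, assumption)+

lemma D_nonneg: "d \<in> D \<Longrightarrow> 0 \<le> d"
  using D_ray by (auto simp: real_ray_def)

lemma real_ray_downward: "y \<in> real_ray a \<Longrightarrow> 0 \<le> x \<Longrightarrow> x \<le> y \<Longrightarrow> x \<in> real_ray a"
  unfolding real_ray_def mem_Collect_eq using le_less_trans[OF ennreal_leI[of x y]] by blast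

lemma D_group:
  "\<exists>G. real_additive_subgroup G \<and> D = G \<inter> real_ray a"
  using group_like unfolding countable_dense_group_like_def by - (elim conjE, assumption)

lemma D_0: "0 \<in> D"
proof -
  have "0 \<in> real_ray a" using a_cases by (auto simp: real_ray_def)
  moreover obtain G where "real_additive_subgroup G" "D = G \<inter> real_ray a" using D_group by blast
  ultimately show ?thesis
    by (simp add: real_additive_subgroup_def)
qed

lemma D_diff: "x \<in> D \<Longrightarrow> y \<in> D \<Longrightarrow> x \<le> y \<Longrightarrow> y - x \<in> D"
proof -
  assume xy: "x \<in> D" "y \<in> D" "x \<le> y"
  obtain G where G: "real_additive_subgroup G" "D = G \<inter> real_ray a" using D_group by blast
  have "y - x \<in> G"
    using xy(1,2) G by (intro real_additive_subgroup_diff) auto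
  moreover have "y - x \<in> real_ray a"
    using xy D_nonneg[of x] D_ray real_ray_downward[of y "y - x"] by auto
  ultimately show ?thesis using G by simp
qed

lemma D_add: "x \<in> D \<Longrightarrow> y \<in> D \<Longrightarrow> x + y \<in> real_ray a \<Longrightarrow> x + y \<in> D"
proof -
  assume xy: "x \<in> D" "y \<in> D" "x + y \<in> real_ray a"
  obtain G where "real_additive_subgroup G" "D = G \<inter> real_ray a" using D_group by blast
  then show ?thesis
    using xy real_additive_subgroup_add[of G x y] by blast
qed

lemma D_approx:
  assumes "y \<in> real_ray a" "0 < e"
  shows "\<exists>d\<in>D. \<bar>d - y\<bar> < e"
proof -
  have "y \<in> closure D" using assms dense_D by blast
  then show ?thesis
    using assms(2) unfolding closure_approachable dist_real_def by simp
qed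

text \<open>Provides room to the right of \<open>x\<close> for the right endpoint of a short
  interval; for \<open>a = 1\<close> the bound is 1 itself.\<close>

lemma real_ray_right_neighbour:
  assumes "x \<in> real_ray a"
  obtains b where "x < b" "\<And>y. 0 \<le> y \<Longrightarrow> y < b \<Longrightarrow> y \<in> real_ray a"
  using a_cases
proof
  assume "a = 1"
  then show thesis using assms by (intro that[of 1]) (auto simp: real_ray_def)
next
  assume "a = \<infinity>"
  then show thesis by (intro that[of "x + 1"]) (auto simp: real_ray_def)
qed

section \<open>The ring of finite unions of intervals with endpoints in \<open>D\<close>\<close>

definition intervals :: "real set set" where
  "intervals = {{g..<h} | g h. g \<in> D \<and> h \<in> D \<and> g \<le> h}"

lemma intervalsI: "g \<in> D \<Longrightarrow> h \<in> D \<Longrightarrow> {g..<h} \<in> intervals"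
proof -
  assume *: "g \<in> D" "h \<in> D"
  have "{g..<h} = {g..<max g h}" by (auto simp: max_def)
  moreover have "max g h \<in> D" using * by (simp add: max_def)
  ultimately show ?thesis using * unfolding intervals_def by fastforce
qed

sublocale semiring_of_sets "real_ray a" intervals
proof
  show "intervals \<subseteq> Pow (real_ray a)"
  proof
    fix S assume "S \<in> intervals"
    then obtain g h where "S = {g..<h}" "g \<in> D" "h \<in> D" unfolding intervals_def by blast
    then show "S \<in> Pow (real_ray a)"
      using D_nonneg[of g] D_ray real_ray_downward[of h] by auto
  qed
  show "{} \<in> intervals"
    using intervalsI[OF D_0 D_0] by simp
next
  fix S T assume "S \<in> intervals" "T \<in> intervals"
  then obtain g h g' h' where ST: "S = {g..<h}" "T = {g'..<h'}" "g' \<le> h'"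
    and D: "g \<in> D" "h \<in> D" "g' \<in> D" "h' \<in> D"
    unfolding intervals_def by blast
  have "S \<inter> T = {max g g'..<min h h'}" using ST by auto
  then show "S \<inter> T \<in> intervals"
    using D by (simp add: intervalsI max_def min_def)
  \<comment> \<open>The parts of \<open>S\<close> to the left and to the right of \<open>T\<close>;
    they are disjoint because \<open>g' \<le> h'\<close>.\<close>
  have "S - T = \<Union>{{g..<min h g'}, {max g h'..<h}}" using ST by auto
  moreover have "disjoint {{g..<min h g'}, {max g h'..<h}}"
    using ST by (auto simp: disjoint_def)
  moreover have "{{g..<min h g'}, {max g h'..<h}} \<subseteq> intervals"
    using D by (simp add: intervalsI max_def min_def)
  ultimately show "\<exists>C\<subseteq>intervals. finite C \<and> disjoint C \<and> S - T = \<Union>C"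
    by (intro exI[of _ "{{g..<min h g'}, {max g h'..<h}}"]) simp
qed

sublocale R0: ring_of_sets "real_ray a" generated_ring
  by (rule generating_ring)

lemma interval_in_ring: "g \<in> D \<Longrightarrow> h \<in> D \<Longrightarrow> {g..<h} \<in> generated_ring"
  by (intro generated_ringI_Basic intervalsI)

text \<open>The bound lies in \<open>D\<close>, hence strictly below \<open>a\<close>. It keeps the
  measures of ring elements in the ray and shows that the whole ray is not in the ring.\<close>

lemma generated_ring_bound:
  assumes "s \<in> generated_ring"
  shows "\<exists>h\<in>D. s \<subseteq> {0..<h}"
proof -
  obtain C where C: "finite C" "C \<subseteq> intervals" "s = \<Union>C"
    using assms by (auto simp: generated_ring_def)
  from C(1,2) have "\<exists>h\<in>D. \<Union>C \<subseteq> {0..<h}"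
  proof (induction C rule: finite_induct)
    case empty
    then show ?case using D_0 by auto
  next
    case (insert S C)
    then obtain h where h: "h \<in> D" "\<Union>C \<subseteq> {0..<h}"
      by auto
    obtain g h' where S: "S = {g..<h'}" "g \<in> D" "h' \<in> D"
      using insert.prems unfolding intervals_def by auto
    have "{0..<h} \<subseteq> {0..<max h h'}" "S \<subseteq> {0..<max h h'}"
      using S D_nonneg[of g] by auto
    then have "\<Union>(insert S C) \<subseteq> {0..<max h h'}" using h(2) by blast
    moreover have "max h h' \<in> D" using h S by (simp add: max_def)
    ultimately show ?case by (rule bexI)
  qed
  then show ?thesis using C by simp
qed

lemma generated_ring_borel:
  assumes "s \<in> generated_ring"
  shows "s \<in> sets lborel"
proof -
  obtain C where C: "finite C" "C \<subseteq> intervals" "s = \<Union>C"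
    using assms by (auto simp: generated_ring_def)
  moreover have "intervals \<subseteq> sets lborel" unfolding intervals_def by auto
  ultimately show ?thesis using sets.finite_Union[of C lborel] by blast
qed

lemma countable_generated_ring: "countable generated_ring"
proof -
  have "intervals \<subseteq> (\<lambda>(g, h). {g..<h}) ` (D \<times> D)"
    unfolding intervals_def by auto
  then have "countable intervals"
    by (rule countable_subset[OF _ countable_image[OF countable_SIGMA[OF countable_D countable_D]]])
  then have "countable (Union ` {C. finite C \<and> C \<subseteq> intervals})"
    by (intro countable_image countable_Collect_finite_subset)
  then show ?thesis
    by (rule countable_subset[rotated]) (auto simp: generated_ring_def)
qed

text \<open>The measure is a finite sum of interval lengths, each in the group \<open>G\<close>. The
  sum is formed in \<open>G\<close>, where no bound has to be watched, and only afterwards placed in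
  the ray by \<open>generated_ring_bound\<close>.\<close>

lemma emeasure_generated_ring:
  assumes "s \<in> generated_ring"
  shows "\<exists>d\<in>D. emeasure lborel s = ennreal d"
proof -
  obtain G where G: "real_additive_subgroup G" "D = G \<inter> real_ray a" using D_group by blast
  obtain C where C: "finite C" "disjoint C" "C \<subseteq> intervals" "s = \<Union>C"
    using assms by (auto simp: generated_ring_def)
  define d :: "real set \<Rightarrow> real" where "d = measure lborel"
  have "\<exists>d\<in>G. 0 \<le> d \<and> emeasure lborel S = ennreal d" if "S \<in> C" for S
  proof -
    obtain g h where "S = {g..<h}" "g \<in> D" "h \<in> D" "g \<le> h"
      using C \<open>S \<in> C\<close> unfolding intervals_def by auto
    moreover then have "h - g \<in> G"
      using D_diff[of g h] G by blast
    ultimately show ?thesis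
      by (intro bexI[of _ "h - g"]) simp_all
  qed
  then have d: "d S \<in> G \<and> 0 \<le> d S \<and> emeasure lborel S = ennreal (d S)" if "S \<in> C" for S
    using that unfolding d_def by (metis Sigma_Algebra.measure_def enn2real_ennreal)
  have "emeasure lborel (\<Union>C) = (\<Sum>S\<in>C. emeasure lborel S)"
  proof (subst sum_emeasure)
    show "(\<lambda>S. S) ` C \<subseteq> sets lborel" using C(3) unfolding intervals_def by auto
    show "disjoint_family_on (\<lambda>S. S) C"
      using C(2) by (auto simp: disjoint_family_on_def disjoint_def)
  qed (use C in auto)
  also have "\<dots> = ennreal (\<Sum>S\<in>C. d S)"
    using d by (simp add: sum_ennreal)
  finally have eq: "emeasure lborel s = ennreal (\<Sum>S\<in>C. d S)"
    using C by simp
  have "(\<Sum>S\<in>C'. d S) \<in> G" if "C' \<subseteq> C" for C'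
    using finite_subset[OF that C(1)] that
  proof (induction C' rule: finite_induct)
    case empty
    then show ?case using G by (simp add: real_additive_subgroup_def)
  next
    case (insert S C')
    then have "d S + sum d C' \<in> G"
      using d[of S] by (intro real_additive_subgroup_add[OF G(1)]) auto
    then show ?case using insert.hyps by simp
  qed
  then have "(\<Sum>S\<in>C. d S) \<in> G" by blast
  moreover obtain h where h: "h \<in> D" "s \<subseteq> {0..<h}"
    using generated_ring_bound[OF assms] by blast
  moreover have "emeasure lborel s \<le> ennreal h"
    using emeasure_mono[OF h(2), of lborel] D_nonneg[OF h(1)] by simp
  moreover have "0 \<le> (\<Sum>S\<in>C. d S)"
    using d by (intro sum_nonneg) auto
  ultimately have "(\<Sum>S\<in>C. d S) \<in> real_ray a"
    using D_nonneg[OF h(1)] D_ray real_ray_downward[of h "sum d C"] unfolding eq by auto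
  with \<open>(\<Sum>S\<in>C. d S) \<in> G\<close> have "(\<Sum>S\<in>C. d S) \<in> D"
    using G by blast
  then show ?thesis using eq by blast
qed

lemma emeasure_generated_ring_pos:
  assumes "s \<in> generated_ring" "s \<noteq> {}"
  shows "0 < emeasure lborel s"
proof -
  obtain C where C: "C \<subseteq> intervals" "s = \<Union>C"
    using assms by (auto simp: generated_ring_def)
  then obtain S where S': "S \<in> C" "S \<noteq> {}" using assms by auto
  then have "S \<in> intervals" using C(1) by blast
  then obtain g h where "S = {g..<h}"
    unfolding intervals_def by blast
  then have S: "S = {g..<h}" "g < h" "S \<subseteq> s"
    using C(2) S' by auto
  then have "0 < emeasure lborel S" by simp
  also have "\<dots> \<le> emeasure lborel s"
    using S(3) assms(1) by (intro emeasure_mono generated_ring_borel)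
  finally show ?thesis .
qed

text \<open>Go through the disjoint intervals of \<open>s\<close> one by one: if the current one has
  length at least \<open>d\<close>, cut it at \<open>g + d\<close>; otherwise take it whole and look
  for the remaining \<open>d - (h - g)\<close>, again in \<open>D\<close>, in the others.\<close>

lemma generated_ring_fill:
  assumes "s \<in> generated_ring" "d \<in> D" "ennreal d \<le> emeasure lborel s"
  shows "\<exists>w\<in>generated_ring. w \<subseteq> s \<and> emeasure lborel w = ennreal d"
proof -
  obtain C where C: "finite C" "disjoint C" "C \<subseteq> intervals" "s = \<Union>C"
    using assms by (auto simp: generated_ring_def)
  from C(1,2,3) assms(2,3)[unfolded C(4)]
  have "\<exists>w\<in>generated_ring. w \<subseteq> \<Union>C \<and> emeasure lborel w = ennreal d"
  proof (induction C arbitrary: d rule: finite_induct)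
    case empty
    then show ?case using generated_ring_empty D_nonneg[of d] by (intro bexI[of _ "{}"]) auto
  next
    case (insert S C)
    obtain g h where S: "S = {g..<h}" "g \<in> D" "h \<in> D" "g \<le> h"
      using insert.prems unfolding intervals_def by auto
    have hg: "h - g \<in> D" using S D_diff by simp
    have C: "disjoint C" "C \<subseteq> intervals" "S \<inter> \<Union>C = {}"
      using insert.prems insert.hyps by (auto simp: disjoint_def)
    show ?case
    proof (cases "d \<le> h - g")
      case True
      \<comment> \<open>The cut point is at most \<open>h\<close>, so it stays in the ray and
        \<open>D_add\<close> puts it into \<open>D\<close>.\<close>
      have "g + d \<in> real_ray a"
        using True S insert.prems D_nonneg[of g] D_nonneg[of d] D_ray real_ray_downward[of h "g + d"]
        by auto
      then have "g + d \<in> D" using S insert.prems by (intro D_add) auto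
      then show ?thesis
        using True S D_nonneg[OF \<open>d \<in> D\<close>]
        by (intro bexI[of _ "{g..<g + d}"] interval_in_ring) auto
    next
      case False
      then have d': "d - (h - g) \<in> D" using hg insert.prems D_diff by simp
      have CR: "\<Union>C \<in> generated_ring"
        using C insert.hyps by (auto simp: generated_ring_def)
      have "ennreal d \<le> emeasure lborel S + emeasure lborel (\<Union>C)"
        using insert.prems S generated_ring_borel[OF CR] C by (subst plus_emeasure) auto
      moreover have "ennreal d = emeasure lborel S + ennreal (d - (h - g))"
        using S False by (simp flip: ennreal_plus)
      ultimately have "ennreal (d - (h - g)) \<le> emeasure lborel (\<Union>C)"
        using S by (simp add: ennreal_add_left_cancel_le)
      then obtain w where w: "w \<in> generated_ring" "w \<subseteq> \<Union>C" "emeasure lborel w = ennreal (d - (h - g))"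
        using insert.IH[OF C(1,2) d'] by blast
      have "emeasure lborel (S \<union> w) = emeasure lborel S + emeasure lborel w"
        using w S C generated_ring_borel[OF w(1)] by (intro plus_emeasure[symmetric]) auto
      also have "\<dots> = ennreal d"
        using S False w by (simp flip: ennreal_plus)
      finally show ?thesis
        using w S by (intro bexI[of _ "S \<union> w"] R0.Un interval_in_ring) (auto intro: interval_in_ring)
    qed
  qed
  then show ?thesis using C by simp
qed

lemma generated_ring_good:
  assumes "s \<in> generated_ring" "t \<in> generated_ring" "emeasure lborel s < emeasure lborel t"
  shows "\<exists>w\<in>generated_ring. w \<subseteq> t \<and> emeasure lborel w = emeasure lborel s"
proof -
  obtain d where "d \<in> D" "emeasure lborel s = ennreal d"
    using emeasure_generated_ring[OF assms(1)] by blast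
  then show ?thesis
    using generated_ring_fill[OF assms(2), of d] assms(3) by simp
qed

text \<open>Density of \<open>D\<close> yields endpoints on both sides of \<open>x\<close>; near the
  left end of the ray the endpoint 0 is used.\<close>

lemma generated_ring_small_cover:
  assumes x: "x \<in> real_ray a" and e: "0 < e"
  shows "\<exists>s\<in>generated_ring. x \<in> s \<and> emeasure lborel s \<le> e"
proof -
  obtain e' where e': "0 < e'" "ennreal e' \<le> e"
  proof (cases e)
    case (real u)
    then show ?thesis using e that[of u] by auto
  next
    case top
    then show ?thesis using that[of 1] by simp
  qed
  have x0: "0 \<le> x" using x by (simp add: real_ray_def)
  obtain b where b: "x < b" "\<And>y. 0 \<le> y \<Longrightarrow> y < b \<Longrightarrow> y \<in> real_ray a"
    using real_ray_right_neighbour[OF x] by blast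
  \<comment> \<open>The first bound keeps \<open>x + \<delta>\<close> in the ray. With
    \<open>h < x + 2 * \<delta>\<close> and \<open>g > x - 2 * \<delta>\<close> the interval is
    shorter than \<open>4 * \<delta>\<close>, which explains the second.\<close>
  define \<delta> where "\<delta> = min ((b - x) / 2) (e' / 4)"
  have \<delta>: "0 < \<delta>" "x + \<delta> < b" "4 * \<delta> \<le> e'"
    using b e' by (auto simp: \<delta>_def min_def field_simps)
  obtain h where h: "h \<in> D" "\<bar>h - (x + \<delta>)\<bar> < \<delta>"
    using D_approx[of "x + \<delta>" \<delta>] b \<delta> x0 by auto
  obtain g where g: "g \<in> D" "g \<le> x" "x - 2 * \<delta> < g"
  proof (cases "\<delta> \<le> x")
    case True
    then have "x - \<delta> \<in> real_ray a" using \<delta> real_ray_downward[OF x, of "x - \<delta>"] by auto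
    then obtain g where "g \<in> D" "\<bar>g - (x - \<delta>)\<bar> < \<delta>"
      using D_approx \<delta> by blast
    then show ?thesis using that[of g] by auto
  next
    case False
    then show ?thesis using that[of 0] D_0 x0 \<delta> by auto
  qed
  have "emeasure lborel {g..<h} = ennreal (h - g)" using g h by simp
  also have "\<dots> \<le> ennreal e'" using g h \<delta> by (intro ennreal_leI) auto
  also have "\<dots> \<le> e" by (rule e'(2))
  finally show ?thesis
    using g h by (intro bexI[of _ "{g..<h}"] interval_in_ring) auto
qed

lemma real_ray_borel: "real_ray a \<in> sets lborel"
proof -
  have "real_ray a = (if a = 1 then {0..<1} else {0..})"
    using a_cases by (auto simp: real_ray_def)
  then show ?thesis by simp
qed

section \<open>Lebesgue measure on the ray, and the probability measure with values
  \<open>D\<close>\<close>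

definition ray_measure :: "real measure" where
  "ray_measure = restrict_space lborel (real_ray a)"

lemma space_ray_measure: "space ray_measure = real_ray a"
  by (simp add: ray_measure_def space_restrict_space)

lemma sets_ray_measure: "S \<subseteq> real_ray a \<Longrightarrow> S \<in> sets lborel \<Longrightarrow> S \<in> sets ray_measure"
  using real_ray_borel unfolding ray_measure_def by (subst sets_restrict_space_iff) auto

lemma emeasure_ray_measure: "S \<subseteq> real_ray a \<Longrightarrow> emeasure ray_measure S = emeasure lborel S"
  using real_ray_borel unfolding ray_measure_def by (subst emeasure_restrict_space) auto

lemma emeasure_space_ray_measure: "emeasure ray_measure (space ray_measure) = a"
proof -
  have *: "emeasure lborel {0::real..} = \<infinity>"
  proof (rule ccontr)
    assume "emeasure lborel {0::real..} \<noteq> \<infinity>"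
    then obtain v where v: "emeasure lborel {0::real..} = ennreal v" "0 \<le> v"
      by (cases "emeasure lborel {0::real..}") auto
    have "ennreal (v + 1) = emeasure lborel {0..<v + 1}" using v by simp
    also have "\<dots> \<le> emeasure lborel {0::real..}" by (intro emeasure_mono) auto
    finally show False using v by (simp add: ennreal_le_iff2)
  qed
  have "real_ray a = (if a = 1 then {0..<1} else {0..})"
    using a_cases by (auto simp: real_ray_def)
  then show ?thesis
    using a_cases * by (auto simp: space_ray_measure emeasure_ray_measure)
qed

lemma generated_ring_subset: "s \<in> generated_ring \<Longrightarrow> s \<subseteq> real_ray a"
  using R0.sets_into_space by blast

lemma emeasure_ray_generated_ring:
  "s \<in> generated_ring \<Longrightarrow> emeasure ray_measure s = emeasure lborel s"
  by (intro emeasure_ray_measure generated_ring_subset)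

lemma measure_ring_generated_ring: "measure_ring ray_measure generated_ring"
proof (rule measure_ring.intro)
  show "ring_of_sets (space ray_measure) generated_ring"
    unfolding space_ray_measure by (rule generating_ring)
  show "countable generated_ring" by (rule countable_generated_ring)
  show "generated_ring \<subseteq> sets ray_measure"
  proof
    fix s assume s: "s \<in> generated_ring"
    show "s \<in> sets ray_measure"
      using generated_ring_subset[OF s] generated_ring_borel[OF s] by (rule sets_ray_measure)
  qed
  show "space ray_measure \<notin> generated_ring"
    unfolding space_ray_measure
  proof
    \<comment> \<open>The bound \<open>h\<close> is itself a point of the ray, but not of
      \<open>{0..<h}\<close>.\<close>
    assume "real_ray a \<in> generated_ring"
    then obtain h where "h \<in> D" "real_ray a \<subseteq> {0..<h}" using generated_ring_bound by blast
    moreover then have "h \<in> {0..<h}" using D_ray by blast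
    ultimately show False by simp
  qed
  show "emeasure ray_measure (space ray_measure) = 1 \<or> emeasure ray_measure (space ray_measure) = \<infinity>"
    unfolding emeasure_space_ray_measure by (rule a_cases)
  show "0 < emeasure ray_measure s" if "s \<in> generated_ring" "s \<noteq> {}" for s
    unfolding emeasure_ray_generated_ring[OF that(1)] using that by (rule emeasure_generated_ring_pos)
  show "\<exists>s\<in>generated_ring. x \<in> s \<and> emeasure ray_measure s \<le> e"
    if xe: "x \<in> space ray_measure" "0 < e" for x e
  proof -
    obtain s where "s \<in> generated_ring" "x \<in> s" "emeasure lborel s \<le> e"
      using generated_ring_small_cover[OF xe[unfolded space_ray_measure]] by blast
    then show ?thesis
      by (intro bexI[of _ s]) (simp_all add: emeasure_ray_generated_ring)
  qed
  show "\<exists>w\<in>generated_ring. w \<subseteq> t \<and> emeasure ray_measure w = emeasure ray_measure s"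
    if st: "s \<in> generated_ring" "t \<in> generated_ring" "emeasure ray_measure s < emeasure ray_measure t" for s t
  proof -
    obtain w where "w \<in> generated_ring" "w \<subseteq> t" "emeasure lborel w = emeasure lborel s"
      using generated_ring_good[OF st(1,2) st(3)[unfolded emeasure_ray_generated_ring[OF st(1)]
            emeasure_ray_generated_ring[OF st(2)]]] by blast
    then show ?thesis
      using st by (intro bexI[of _ w]) (simp_all add: emeasure_ray_generated_ring)
  qed
qed

lemma generated_ring_values:
  "{measure ray_measure s | s. s \<in> generated_ring} = D"
proof (intro equalityI subsetI)
  fix v assume "v \<in> {measure ray_measure s | s. s \<in> generated_ring}"
  then obtain s where s: "s \<in> generated_ring" "v = measure ray_measure s" by blast
  then obtain d where "d \<in> D" "emeasure ray_measure s = ennreal d"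
    using emeasure_generated_ring[OF s(1)] emeasure_ray_generated_ring[OF s(1)] by auto
  then show "v \<in> D" using s D_nonneg by (simp add: measure_def)
next
  fix d assume d: "d \<in> D"
  have "{0..<d} \<in> generated_ring" using d D_0 by (rule interval_in_ring[rotated])
  moreover then have "emeasure ray_measure {0..<d} = ennreal d"
    using D_nonneg[OF d] by (simp add: emeasure_ray_generated_ring)
  ultimately show "d \<in> {measure ray_measure s | s. s \<in> generated_ring}"
    using D_nonneg[OF d] by (auto simp: measure_def intro!: exI[of _ "{0..<d}"])
qed

end

lemma exists_good_probability:
  assumes "countable_dense_group_like 1 D"
  shows "\<exists>(X :: (nat \<Rightarrow> bool) topology) \<mu>. noncompact_lc_Cantor X \<and> good_measure X \<mu> \<and>
    prob_space \<mu> \<and> compact_open_values X \<mu> = D"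
proof -
  interpret V: group_like_values 1 D
    using assms by unfold_locales auto
  interpret S: measure_ring V.ray_measure V.generated_ring
    by (rule V.measure_ring_generated_ring)
  have prob: "prob_space S.stone_measure"
    by (rule prob_spaceI)
      (simp add: S.space_stone_measure S.emeasure_topspace_stone V.emeasure_space_ray_measure)
  have fin: "emeasure V.ray_measure s < \<infinity>" if s: "s \<in> V.generated_ring" for s
  proof -
    obtain d where "emeasure lborel s = ennreal d"
      using V.emeasure_generated_ring[OF s] by (rule bexE)
    then show ?thesis
      by (simp add: V.emeasure_ray_generated_ring[OF s])
  qed
  have "compact_open_values S.stone S.stone_measure
      = {measure V.ray_measure s | s. s \<in> V.generated_ring}"
    unfolding S.compact_open_values_stone by (intro Collect_cong ex_cong1 refl) (use fin in auto)
  then have "compact_open_values S.stone S.stone_measure = D"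
    by (simp only: V.generated_ring_values)
  then show ?thesis
    by (intro exI[of _ S.stone] exI[of _ S.stone_measure] conjI
        S.noncompact_lc_Cantor_stone S.good_stone prob)
qed

section \<open>Prescribing the defective set\<close>

lemma lc_zero_dim_compact_open_base:
  assumes A: "lc_zero_dim_metric_space A" and V: "openin A V" and x: "x \<in> V"
  shows "\<exists>B. compact_open A B \<and> x \<in> B \<and> B \<subseteq> V"
proof -
  have "x \<in> topspace A" using V x by (meson openin_subset subsetD)
  moreover have "locally_compact_space A"
    using A by (simp add: lc_zero_dim_metric_space_def)
  ultimately obtain U K where U: "openin A U" "compactin A K" "x \<in> U" "U \<subseteq> K"
    unfolding locally_compact_space_def by meson
  \<comment> \<open>A clopen neighbourhood chosen inside the compact set \<open>K\<close> is a
    closed subset of it, hence compact.\<close>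
  have "openin A (V \<inter> U)" "x \<in> V \<inter> U" using V U x by auto
  moreover have "neighbourhood_base_of (\<lambda>U. closedin A U \<and> openin A U) A"
    using A unfolding dimension_le_0_neighbourhood_base_of_clopen[symmetric]
    by (simp add: lc_zero_dim_metric_space_def)
  ultimately obtain W C where "closedin A C \<and> openin A C" "x \<in> W" "W \<subseteq> C" "C \<subseteq> V \<inter> U"
    unfolding neighbourhood_base_of by meson
  moreover then have "compactin A C" using U by (intro closed_compactin[OF U(2)]) auto
  ultimately show ?thesis unfolding compact_open_def by blast
qed

text \<open>The index is read as a pair: the first component selects the element, the second one
  only produces repetitions.\<close>

lemma countable_recurrent_sequence:
  assumes "countable S" "S \<noteq> {}"
  shows "\<exists>f::nat \<Rightarrow> 'c. \<forall>s\<in>S. infinite {n. f n = s}"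
proof -
  define f where "f n = from_nat_into S (fst (prod_decode n))" for n
  have "infinite {n. f n = s}" if "s \<in> S" for s
  proof -
    obtain i where i: "from_nat_into S i = s"
      using from_nat_into_surj[OF assms(1) \<open>s \<in> S\<close>] by (elim exE)
    have "range (\<lambda>j. prod_encode (i, j)) \<subseteq> {n. f n = s}"
      using i by (auto simp: f_def)
    moreover have "infinite (range (\<lambda>j. prod_encode (i, j)))"
      by (intro range_inj_infinite injI) simp
    ultimately show ?thesis by (metis finite_subset)
  qed
  then show ?thesis by (intro exI[of _ f]) simp
qed

text \<open>Here \<open>c\<close> is the common length of the blocks. \<open>infinite_Some\<close>
  makes the behaviour of a ring element near infinity determine its compact open set
  \<open>B\<close>, and makes its measure infinite when \<open>B\<close> is non-empty;
  \<open>infinite_None\<close> keeps the whole half-line out of the ring.\<close>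

locale prescribed_defect = group_like_values \<top> D
  for D :: "real set" +
  fixes A :: "'b topology" and c :: real and pt :: "nat \<Rightarrow> 'b option"
  assumes A: "lc_zero_dim_metric_space A"
    and c_D: "c \<in> D" and c_pos: "0 < c"
    and infinite_None: "infinite {n. pt n = None}"
    and infinite_Some: "\<And>B. compact_open A B \<Longrightarrow> B \<noteq> {} \<Longrightarrow> infinite {n. pt n \<in> Some ` B}"
begin

section \<open>Blocks, and the ring of sets that are unions of blocks near infinity\<close>

lemma Hausdorff_A: "Hausdorff_space A"
  using A by (simp add: lc_zero_dim_metric_space_def metrizable_imp_Hausdorff_space)

lemma ray: "real_ray \<top> = {0..}"
  by (auto simp: real_ray_def)

lemma multiple_in_D: "real n * c \<in> D"
proof (induction n)
  case 0
  then show ?case by (simp add: D_0)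
next
  case (Suc n)
  have "real n * c + c \<in> D"
    using Suc c_D c_pos by (intro D_add) (auto simp: ray)
  then show ?case by (simp add: algebra_simps)
qed

definition block :: "nat \<Rightarrow> real set" where
  "block n = {real n * c..<real (Suc n) * c}"

text \<open>Turns membership in a block into an equation for its index, so disjointness of blocks
  and membership in \<open>blocks B\<close> become computations.\<close>

lemma mem_block_iff: "x \<in> block n \<longleftrightarrow> 0 \<le> x \<and> nat \<lfloor>x / c\<rfloor> = n"
proof -
  have "x \<in> block n \<longleftrightarrow> real n \<le> x / c \<and> x / c < real n + 1"
    using c_pos by (simp add: block_def field_simps)
  also have "\<dots> \<longleftrightarrow> \<lfloor>x / c\<rfloor> = int n"
    by (auto simp: floor_eq_iff)
  also have "\<dots> \<longleftrightarrow> 0 \<le> x \<and> nat \<lfloor>x / c\<rfloor> = n"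
  proof -
    have "0 \<le> x \<longleftrightarrow> 0 \<le> \<lfloor>x / c\<rfloor>" using c_pos by (simp add: zero_le_divide_iff)
    then show ?thesis by linarith
  qed
  finally show ?thesis .
qed

lemma block_in_ring: "block n \<in> generated_ring"
  unfolding block_def by (rule interval_in_ring[OF multiple_in_D multiple_in_D])

lemma emeasure_block: "emeasure lborel (block n) = ennreal c"
  using c_pos by (simp add: block_def algebra_simps)

lemma block_nonempty: "real n * c \<in> block n"
  using c_pos by (simp add: block_def)

text \<open>\<open>pt n\<close> is the point of \<open>A\<close> attached to the \<open>n\<close>-th block; blocks with \<open>pt n = None\<close> escape to
  infinity, which keeps the space non-compact even when \<open>A\<close> is compact or empty.\<close>

definition blocks :: "'b set \<Rightarrow> real set" where
  "blocks B = (\<Union>n\<in>{n. pt n \<in> Some ` B}. block n)"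

lemma mem_blocks_iff: "x \<in> blocks B \<longleftrightarrow> 0 \<le> x \<and> pt (nat \<lfloor>x / c\<rfloor>) \<in> Some ` B"
  unfolding blocks_def UN_iff mem_block_iff by simp

text \<open>A cut at a multiple of \<open>c\<close> splits no block, so finitely many whole blocks
  remain.\<close>

lemma blocks_truncate: "blocks B \<inter> {0..<real N * c} \<in> generated_ring"
proof -
  have "blocks B \<inter> {0..<real N * c} = (\<Union>n\<in>{n \<in> {..<N}. pt n \<in> Some ` B}. block n)"
  proof (intro equalityI subsetI)
    fix x assume "x \<in> blocks B \<inter> {0..<real N * c}"
    then obtain n where n: "pt n \<in> Some ` B" "x \<in> block n" "x < real N * c"
      by (auto simp: blocks_def)
    then have "real n * c < real N * c" by (auto simp: block_def)
    then have "n < N" using c_pos by simp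
    then show "x \<in> (\<Union>n\<in>{n \<in> {..<N}. pt n \<in> Some ` B}. block n)" using n by blast
  next
    fix x assume "x \<in> (\<Union>n\<in>{n \<in> {..<N}. pt n \<in> Some ` B}. block n)"
    then obtain n where n: "pt n \<in> Some ` B" "x \<in> block n" "n < N" by auto
    then have "real (Suc n) * c \<le> real N * c" using c_pos by (intro mult_right_mono) auto
    then have "x < real N * c" using n by (simp add: block_def)
    then show "x \<in> blocks B \<inter> {0..<real N * c}"
      using n mem_block_iff[of x n] by (auto simp: blocks_def)
  qed
  also have "\<dots> \<in> generated_ring"
    by (intro R0.finite_UN block_in_ring) simp
  finally show ?thesis .
qed

text \<open>\<open>B\<close> is the trace of \<open>E\<close> at infinity. The threshold is a block
  boundary, so that blocks are compared as a whole.\<close>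

definition eventually_blocks :: "real set \<Rightarrow> 'b set \<Rightarrow> bool" where
  "eventually_blocks E B \<longleftrightarrow> compact_open A B \<and> (\<exists>N::nat. \<forall>x\<ge>real N * c. x \<in> E \<longleftrightarrow> x \<in> blocks B)"

text \<open>The truncation condition expresses that \<open>E\<close> is locally a finite union of
  intervals with endpoints in \<open>D\<close>.\<close>

definition block_ring :: "real set set" where
  "block_ring = {E. E \<subseteq> {0..} \<and> (\<forall>N. E \<inter> {0..<real N * c} \<in> generated_ring) \<and>
     (\<exists>B. eventually_blocks E B)}"

lemma eventually_blocks_bounds:
  assumes "eventually_blocks E B"
  obtains N where "\<And>N'::nat. N \<le> N' \<Longrightarrow> \<forall>x\<ge>real N' * c. x \<in> E \<longleftrightarrow> x \<in> blocks B"
proof -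
  obtain N :: nat where N: "\<forall>x\<ge>real N * c. x \<in> E \<longleftrightarrow> x \<in> blocks B"
    using assms by (auto simp: eventually_blocks_def)
  have "\<forall>x\<ge>real N' * c. x \<in> E \<longleftrightarrow> x \<in> blocks B" if "N \<le> N'" for N'
  proof (intro allI impI)
    fix x assume x: "real N' * c \<le> x"
    have "real N * c \<le> real N' * c" using that c_pos by simp
    then have "real N * c \<le> x" using x by (rule order_trans)
    then show "x \<in> E \<longleftrightarrow> x \<in> blocks B" using N by simp
  qed
  then show thesis by (rule that)
qed

text \<open>A block carries at most one point of \<open>A\<close>, so \<open>blocks\<close> commutes
  with unions and differences; beyond the larger threshold both sets are given by
  \<open>blocks\<close>.\<close>

lemma eventually_blocks_op:
  assumes E: "eventually_blocks E B" and F: "eventually_blocks F C"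
  shows "eventually_blocks (E \<union> F) (B \<union> C)" "eventually_blocks (E - F) (B - C)"
proof -
  obtain N where N: "\<And>N'::nat. N \<le> N' \<Longrightarrow> \<forall>x\<ge>real N' * c. x \<in> E \<longleftrightarrow> x \<in> blocks B"
    using eventually_blocks_bounds[OF E] by blast
  obtain M where M: "\<And>N'::nat. M \<le> N' \<Longrightarrow> \<forall>x\<ge>real N' * c. x \<in> F \<longleftrightarrow> x \<in> blocks C"
    using eventually_blocks_bounds[OF F] by blast
  have *: "\<forall>x\<ge>real (max N M) * c. (x \<in> E \<longleftrightarrow> x \<in> blocks B) \<and> (x \<in> F \<longleftrightarrow> x \<in> blocks C)"
    using N[of "max N M"] M[of "max N M"] by simp
  have co: "compact_open A B" "compact_open A C"
    using E F by (auto simp: eventually_blocks_def)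
  have Un: "x \<in> blocks (B \<union> C) \<longleftrightarrow> x \<in> blocks B \<or> x \<in> blocks C"
    and Diff: "x \<in> blocks (B - C) \<longleftrightarrow> x \<in> blocks B \<and> x \<notin> blocks C" for x
    by (auto simp: mem_blocks_iff)
  show "eventually_blocks (E \<union> F) (B \<union> C)"
    unfolding eventually_blocks_def
  proof (intro conjI exI[of _ "max N M"])
    show "\<forall>x\<ge>real (max N M) * c. x \<in> E \<union> F \<longleftrightarrow> x \<in> blocks (B \<union> C)"
      using * unfolding Un by simp
  qed (rule compact_open_Un[OF co])
  show "eventually_blocks (E - F) (B - C)"
    unfolding eventually_blocks_def
  proof (intro conjI exI[of _ "max N M"])
    show "\<forall>x\<ge>real (max N M) * c. x \<in> E - F \<longleftrightarrow> x \<in> blocks (B - C)"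
      using * unfolding Diff by simp
  qed (rule compact_open_Diff[OF Hausdorff_A co])
qed

lemma eventually_blocks_contains:
  assumes E: "eventually_blocks E B"
  obtains N where "\<And>n. N \<le> n \<Longrightarrow> pt n \<in> Some ` B \<Longrightarrow> block n \<subseteq> E"
proof -
  obtain N :: nat where N: "\<forall>x\<ge>real N * c. x \<in> E \<longleftrightarrow> x \<in> blocks B"
    using assms by (auto simp: eventually_blocks_def)
  have "block n \<subseteq> E" if n: "N \<le> n" "pt n \<in> Some ` B" for n
  proof
    fix x assume x: "x \<in> block n"
    have "real N * c \<le> real n * c" using n c_pos by simp
    also have "\<dots> \<le> x" using x by (simp add: block_def)
    finally have "x \<in> E \<longleftrightarrow> x \<in> blocks B" using N by simp
    then show "x \<in> E" using x n by (auto simp: blocks_def)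
  qed
  then show thesis by (rule that)
qed

text \<open>The empty set \<open>E - F\<close> has trace \<open>B - C\<close>. Were this non-empty,
  infinitely many blocks would carry a point of it, and those far out would be contained in the
  empty set.\<close>

lemma eventually_blocks_mono:
  assumes "eventually_blocks E B" "eventually_blocks F C" "E \<subseteq> F"
  shows "B \<subseteq> C"
proof -
  have diff: "eventually_blocks {} (B - C)"
    using eventually_blocks_op(2)[OF assms(1,2)] assms(3) by (simp add: Diff_eq_empty_iff[THEN iffD2])
  obtain N where N: "\<And>n. N \<le> n \<Longrightarrow> pt n \<in> Some ` (B - C) \<Longrightarrow> block n \<subseteq> {}"
    using eventually_blocks_contains[OF diff] by blast
  have "{n. pt n \<in> Some ` (B - C)} \<subseteq> {..<N}"
  proof
    fix n assume "n \<in> {n. pt n \<in> Some ` (B - C)}"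
    then show "n \<in> {..<N}" using N[of n] block_nonempty[of n] by (cases "N \<le> n") auto
  qed
  then have "finite {n. pt n \<in> Some ` (B - C)}" by (rule finite_subset) simp
  then have "B - C = {}"
    using infinite_Some[of "B - C"] diff by (auto simp: eventually_blocks_def)
  then show ?thesis by blast
qed

lemma eventually_blocks_unique:
  "eventually_blocks E B \<Longrightarrow> eventually_blocks E C \<Longrightarrow> B = C"
  using eventually_blocks_mono[of E B E C] eventually_blocks_mono[of E C E B] by blast

lemma blocks_in_ring: "compact_open A B \<Longrightarrow> blocks B \<in> block_ring"
  unfolding block_ring_def mem_Collect_eq
proof (intro conjI allI exI[of _ B])
  show "blocks B \<subseteq> {0..}" by (auto simp: mem_blocks_iff)
qed (auto simp: blocks_truncate eventually_blocks_def)

lemma eventually_blocks_blocks: "compact_open A B \<Longrightarrow> eventually_blocks (blocks B) B"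
  by (simp add: eventually_blocks_def)

text \<open>A finite union of intervals is bounded, so its trace at infinity is empty.\<close>

lemma generated_ring_in_block_ring:
  assumes s: "s \<in> generated_ring"
  shows "s \<in> block_ring"
  unfolding block_ring_def mem_Collect_eq
proof (intro conjI allI exI[of _ "{}"])
  show "s \<subseteq> {0..}" using generated_ring_subset[OF s] by (simp add: ray)
  show "s \<inter> {0..<real N * c} \<in> generated_ring" for N
    using s by (intro generated_ring_Int interval_in_ring D_0 multiple_in_D)
  obtain h where h: "s \<subseteq> {0..<h}" using generated_ring_bound[OF s] by blast
  obtain N :: nat where "h / c \<le> real N" using real_arch_simple by blast
  then have "h \<le> real N * c" using c_pos by (simp add: field_simps)
  then have "\<forall>x\<ge>real N * c. x \<in> s \<longleftrightarrow> x \<in> blocks {}"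
    using h by (force simp: mem_blocks_iff)
  then show "eventually_blocks s {}"
    unfolding eventually_blocks_def by (intro conjI exI[of _ N]) simp_all
qed

lemma block_ring_truncate: "E \<in> block_ring \<Longrightarrow> E \<inter> {0..<real N * c} \<in> generated_ring"
  by (simp add: block_ring_def)

lemma block_ring_nonneg: "E \<in> block_ring \<Longrightarrow> E \<subseteq> {0..}"
  by (simp add: block_ring_def)

lemma eventually_blocks_empty:
  assumes E: "E \<in> block_ring" "eventually_blocks E {}"
  shows "E \<in> generated_ring"
proof -
  obtain N :: nat where N: "\<forall>x\<ge>real N * c. x \<in> E \<longleftrightarrow> x \<in> blocks {}"
    using E(2) by (auto simp: eventually_blocks_def)
  have "E \<subseteq> {0..<real N * c}"
  proof
    fix x assume x: "x \<in> E"
    then have "\<not> real N * c \<le> x" using N by (auto simp: mem_blocks_iff)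
    then show "x \<in> {0..<real N * c}" using x block_ring_nonneg[OF E(1)] by auto
  qed
  then have "E = E \<inter> {0..<real N * c}" by blast
  then show ?thesis using block_ring_truncate[OF E(1)] by metis
qed

lemma block_ring_UN: "E \<in> block_ring \<Longrightarrow> E = (\<Union>N. E \<inter> {0..<real N * c})"
proof (intro equalityI subsetI)
  fix x assume E: "E \<in> block_ring" and x: "x \<in> E"
  obtain N :: nat where "x / c < real N" using reals_Archimedean2 by blast
  then have "x < real N * c" using c_pos by (simp add: field_simps)
  then show "x \<in> (\<Union>N. E \<inter> {0..<real N * c})"
    using x block_ring_nonneg[OF E] by auto
qed auto

lemma block_ring_borel: "E \<in> block_ring \<Longrightarrow> E \<in> sets lborel"
proof -
  assume E: "E \<in> block_ring"
  have "(\<Union>N. E \<inter> {0..<real N * c}) \<in> sets lborel"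
    by (intro sets.countable_UN image_subsetI generated_ring_borel block_ring_truncate[OF E])
  then show ?thesis using block_ring_UN[OF E] by metis
qed

text \<open>A non-empty trace forces \<open>E\<close> to contain infinitely many disjoint blocks,
  each of length \<open>c\<close>.\<close>

lemma emeasure_eventually_blocks:
  assumes E: "E \<in> block_ring" "eventually_blocks E B" "B \<noteq> {}"
  shows "emeasure lborel E = \<infinity>"
proof (rule ccontr)
  assume "emeasure lborel E \<noteq> \<infinity>"
  then obtain v where v: "emeasure lborel E = ennreal v" "0 \<le> v"
    by (cases "emeasure lborel E") auto
  obtain N where N: "\<And>n. N \<le> n \<Longrightarrow> pt n \<in> Some ` B \<Longrightarrow> block n \<subseteq> E"
    using eventually_blocks_contains[OF E(2)] by blast
  obtain k :: nat where "v / c < real k" using reals_Archimedean2 by blast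
  then have k: "v < real k * c" using c_pos by (simp add: field_simps)
  have "infinite {n. pt n \<in> Some ` B}"
    using E by (intro infinite_Some) (auto simp: eventually_blocks_def)
  then have "infinite ({n. pt n \<in> Some ` B} - {..<N})" by (rule Diff_infinite_finite[rotated]) simp
  then obtain F where F: "finite F" "card F = k" "F \<subseteq> {n. pt n \<in> Some ` B} - {..<N}"
    using infinite_arbitrarily_large by metis
  have "ennreal (real k * c) = (\<Sum>n\<in>F. emeasure lborel (block n))"
    using F c_pos by (simp add: emeasure_block ennreal_of_nat_eq_real_of_nat ennreal_mult)
  also have "\<dots> = emeasure lborel (\<Union>n\<in>F. block n)"
  proof (rule sum_emeasure)
    show "block ` F \<subseteq> sets lborel" by (auto simp: block_def)
    show "disjoint_family_on block F"
      unfolding disjoint_family_on_def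
    proof (intro ballI impI)
      fix m n :: nat assume "m \<noteq> n"
      then show "block m \<inter> block n = {}" by (auto simp: mem_block_iff)
    qed
  qed (rule F)
  also have "\<dots> \<le> emeasure lborel E"
  proof (rule emeasure_mono)
    show "(\<Union>n\<in>F. block n) \<subseteq> E" using F(3) by (intro UN_least N) auto
  qed (rule block_ring_borel[OF E(1)])
  finally show False using v k by (simp add: ennreal_le_iff)
qed

text \<open>Finite measure forces an empty trace, so \<open>E\<close> is bounded: the new ring
  acquires no new finite values.\<close>

lemma block_ring_finite:
  assumes E: "E \<in> block_ring" and fin: "emeasure lborel E < \<infinity>"
  shows "E \<in> generated_ring"
proof -
  obtain B where B: "eventually_blocks E B" using E by (auto simp: block_ring_def)
  have "B = {}"
    using emeasure_eventually_blocks[OF E B] fin by (cases "B = {}") simp_all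
  then show ?thesis using eventually_blocks_empty[OF E] B by simp
qed

text \<open>A member is determined by a threshold \<open>N\<close>, its truncation there and its
  trace, each from a countable set.\<close>

lemma countable_block_ring: "countable block_ring"
proof -
  have "block_ring \<subseteq> (\<lambda>(s, B, N::nat). s \<union> (blocks B \<inter> {real N * c..})) `
      (generated_ring \<times> {B. compact_open A B} \<times> UNIV)"
  proof
    fix E assume E: "E \<in> block_ring"
    then obtain B where B: "eventually_blocks E B" by (auto simp: block_ring_def)
    then obtain N :: nat where N: "\<forall>x\<ge>real N * c. x \<in> E \<longleftrightarrow> x \<in> blocks B"
      by (auto simp: eventually_blocks_def)
    have "E = (E \<inter> {0..<real N * c}) \<union> (blocks B \<inter> {real N * c..})"
    proof (rule set_eqI)
      fix x show "x \<in> E \<longleftrightarrow> x \<in> (E \<inter> {0..<real N * c}) \<union> (blocks B \<inter> {real N * c..})"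
        using N block_ring_nonneg[OF E] by (cases "real N * c \<le> x") auto
    qed
    moreover have "E \<inter> {0..<real N * c} \<in> generated_ring" "compact_open A B"
      using block_ring_truncate[OF E] B by (auto simp: eventually_blocks_def)
    ultimately show "E \<in> (\<lambda>(s, B, N::nat). s \<union> (blocks B \<inter> {real N * c..})) `
      (generated_ring \<times> {B. compact_open A B} \<times> UNIV)"
      by (intro image_eqI[of _ _ "(E \<inter> {0..<real N * c}, B, N)"]) simp_all
  qed
  moreover have "countable {B. compact_open A B}"
    using A by (intro countable_compact_open) (simp add: lc_zero_dim_metric_space_def)
  ultimately show ?thesis
    using countable_generated_ring
    by (elim countable_subset) (intro countable_image countable_SIGMA countableI_type)
qed

lemma block_ring_ring: "ring_of_sets {0..} block_ring"
proof (rule ring_of_setsI)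
  show "block_ring \<subseteq> Pow {0..}" using block_ring_nonneg by blast
  show "{} \<in> block_ring" by (rule generated_ring_in_block_ring[OF generated_ring_empty])
  fix E F assume E: "E \<in> block_ring" and F: "F \<in> block_ring"
  obtain B C where B: "eventually_blocks E B" and C: "eventually_blocks F C"
    using E F by (auto simp: block_ring_def)
  show "E \<union> F \<in> block_ring"
    unfolding block_ring_def mem_Collect_eq
  proof (intro conjI allI exI[of _ "B \<union> C"])
    show "E \<union> F \<subseteq> {0..}" using block_ring_nonneg E F by simp
    show "(E \<union> F) \<inter> {0..<real N * c} \<in> generated_ring" for N
      unfolding Int_Un_distrib2
      by (rule R0.Un[OF block_ring_truncate[OF E] block_ring_truncate[OF F]])
  qed (rule eventually_blocks_op[OF B C])
  show "E - F \<in> block_ring"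
    unfolding block_ring_def mem_Collect_eq
  proof (intro conjI allI exI[of _ "B - C"])
    show "E - F \<subseteq> {0..}" using block_ring_nonneg[OF E] by blast
    show "(E - F) \<inter> {0..<real N * c} \<in> generated_ring" for N
    proof -
      have "(E - F) \<inter> {0..<real N * c} = E \<inter> {0..<real N * c} - F \<inter> {0..<real N * c}" by blast
      then show ?thesis
        using R0.Diff[OF block_ring_truncate[OF E] block_ring_truncate[OF F]] by simp
    qed
  qed (rule eventually_blocks_op[OF B C])
qed

lemma emeasure_ray_block_ring:
  "E \<in> block_ring \<Longrightarrow> emeasure ray_measure E = emeasure lborel E"
  using block_ring_nonneg by (intro emeasure_ray_measure) (simp add: ray)

text \<open>\<open>s\<close> has finite measure and so belongs to the interval ring. By continuity
  from below some truncation of \<open>t\<close> already exceeds it in measure, and the interval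
  ring provides \<open>w\<close> inside this truncation.\<close>

lemma block_ring_good:
  assumes s: "s \<in> block_ring" and t: "t \<in> block_ring" and less: "emeasure lborel s < emeasure lborel t"
  shows "\<exists>w\<in>generated_ring. w \<subseteq> t \<and> emeasure lborel w = emeasure lborel s"
proof -
  have "emeasure lborel s < \<infinity>" using less_le_trans[OF less top_greatest] by simp
  then have s': "s \<in> generated_ring" by (rule block_ring_finite[OF s])
  have "(SUP N. emeasure lborel (t \<inter> {0..<real N * c})) = emeasure lborel (\<Union>N. t \<inter> {0..<real N * c})"
  proof (rule SUP_emeasure_incseq)
    show "range (\<lambda>N. t \<inter> {0..<real N * c}) \<subseteq> sets lborel"
      by (intro image_subsetI generated_ring_borel block_ring_truncate[OF t])
    show "incseq (\<lambda>N. t \<inter> {0..<real N * c})"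
    proof (rule incseq_SucI)
      fix N :: nat
      have "real N * c \<le> real (Suc N) * c" using c_pos by simp
      then show "t \<inter> {0..<real N * c} \<subseteq> t \<inter> {0..<real (Suc N) * c}" by auto
    qed
  qed
  also have "\<dots> = emeasure lborel t" using block_ring_UN[OF t] by simp
  finally have "emeasure lborel s < (SUP N. emeasure lborel (t \<inter> {0..<real N * c}))"
    using less by simp
  then obtain N where N: "emeasure lborel s < emeasure lborel (t \<inter> {0..<real N * c})"
    by (auto simp: less_SUP_iff)
  obtain w where "w \<in> generated_ring" "w \<subseteq> t \<inter> {0..<real N * c}" "emeasure lborel w = emeasure lborel s"
    using generated_ring_good[OF s' block_ring_truncate[OF t] N] by blast
  then show ?thesis by blast
qed

lemma measure_ring_block_ring: "measure_ring ray_measure block_ring"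
proof (rule measure_ring.intro)
  show "ring_of_sets (space ray_measure) block_ring"
    unfolding space_ray_measure ray by (rule block_ring_ring)
  show "countable block_ring" by (rule countable_block_ring)
  show "block_ring \<subseteq> sets ray_measure"
  proof
    fix s assume s: "s \<in> block_ring"
    show "s \<in> sets ray_measure"
      by (rule sets_ray_measure) (use block_ring_nonneg[OF s] block_ring_borel[OF s] in \<open>simp_all add: ray\<close>)
  qed
  show "space ray_measure \<notin> block_ring"
    unfolding space_ray_measure ray
  proof
    assume "{0..} \<in> block_ring"
    then obtain B where "eventually_blocks {0..} B" by (auto simp: block_ring_def)
    then obtain N :: nat where N: "\<forall>x\<ge>real N * c. x \<in> {0..} \<longleftrightarrow> x \<in> blocks B"
      by (auto simp: eventually_blocks_def)
    \<comment> \<open>A block without a point, beyond the threshold, lies in the half-line but in no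
      set \<open>blocks B\<close>.\<close>
    obtain n where n: "N \<le> n" "pt n = None"
      using infinite_None unfolding infinite_nat_iff_unbounded_le by auto
    have "real N * c \<le> real n * c" "0 \<le> real n * c" using n c_pos by simp_all
    then have "real n * c \<in> blocks B" using N by simp
    moreover have "nat \<lfloor>real n * c / c\<rfloor> = n" using c_pos by simp
    ultimately show False unfolding mem_blocks_iff using n by auto
  qed
  show "emeasure ray_measure (space ray_measure) = 1 \<or> emeasure ray_measure (space ray_measure) = \<infinity>"
    unfolding emeasure_space_ray_measure by simp
  show "0 < emeasure ray_measure s" if s: "s \<in> block_ring" "s \<noteq> {}" for s
  proof -
    obtain N where N: "s \<inter> {0..<real N * c} \<noteq> {}" using block_ring_UN[OF s(1)] s(2) by blast
    have "0 < emeasure lborel (s \<inter> {0..<real N * c})"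
      using block_ring_truncate[OF s(1)] N by (rule emeasure_generated_ring_pos)
    also have "\<dots> \<le> emeasure lborel s"
      by (rule emeasure_mono) (auto intro: block_ring_borel[OF s(1), simplified])
    finally show ?thesis by (simp add: emeasure_ray_block_ring s)
  qed
  show "\<exists>s\<in>block_ring. x \<in> s \<and> emeasure ray_measure s \<le> e"
    if xe: "x \<in> space ray_measure" "0 < e" for x e
  proof -
    obtain s where "s \<in> generated_ring" "x \<in> s" "emeasure lborel s \<le> e"
      using generated_ring_small_cover[OF xe[unfolded space_ray_measure]] by blast
    then show ?thesis
      by (intro bexI[of _ s]) (simp_all add: emeasure_ray_generated_ring generated_ring_in_block_ring)
  qed
  show "\<exists>w\<in>block_ring. w \<subseteq> t \<and> emeasure ray_measure w = emeasure ray_measure s"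
    if st: "s \<in> block_ring" "t \<in> block_ring" "emeasure ray_measure s < emeasure ray_measure t" for s t
  proof -
    obtain w where "w \<in> generated_ring" "w \<subseteq> t" "emeasure lborel w = emeasure lborel s"
      using block_ring_good[OF st(1,2) st(3)[unfolded emeasure_ray_block_ring[OF st(1)]
            emeasure_ray_block_ring[OF st(2)]]] by blast
    then show ?thesis
      using st by (intro bexI[of _ w])
        (simp_all add: emeasure_ray_generated_ring emeasure_ray_block_ring generated_ring_in_block_ring)
  qed
qed

section \<open>The Stone space of the block ring and its defective set\<close>

sublocale S: measure_ring ray_measure block_ring
  by (rule measure_ring_block_ring)

lemma block_ring_values: "compact_open_values S.stone S.stone_measure = D"
proof -
  have "s \<in> block_ring \<and> emeasure ray_measure s < \<infinity> \<longleftrightarrow> s \<in> generated_ring" for s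
  proof
    assume s: "s \<in> block_ring \<and> emeasure ray_measure s < \<infinity>"
    then have "emeasure lborel s < \<infinity>" using emeasure_ray_block_ring[of s] by simp
    then show "s \<in> generated_ring" using s by (intro block_ring_finite) simp_all
  next
    assume s: "s \<in> generated_ring"
    then obtain d where "emeasure lborel s = ennreal d"
      using emeasure_generated_ring[OF s] by (elim bexE)
    then show "s \<in> block_ring \<and> emeasure ray_measure s < \<infinity>"
      by (simp add: emeasure_ray_generated_ring s generated_ring_in_block_ring)
  qed
  then show ?thesis
    unfolding S.compact_open_values_stone by (simp only: generated_ring_values)
qed

text \<open>The trace at infinity of the \<open>n\<close>-th ring element; \<open>THE\<close> is
  justified by \<open>eventually_blocks_unique\<close>.\<close>

definition base_of :: "nat \<Rightarrow> 'b set" where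
  "base_of n = (THE B. eventually_blocks (S.r n) B)"

lemma eventually_blocks_base_of: "eventually_blocks (S.r n) (base_of n)"
proof -
  obtain B where B: "eventually_blocks (S.r n) B"
    using S.r_in[of n] by (auto simp: block_ring_def)
  then show ?thesis
    unfolding base_of_def by (rule theI) (rule eventually_blocks_unique[OF _ B])
qed

lemma base_of_eq: "eventually_blocks (S.r n) B \<Longrightarrow> base_of n = B"
  by (rule eventually_blocks_unique[OF eventually_blocks_base_of])

lemma compact_open_base_of: "compact_open A (base_of n)"
  using eventually_blocks_base_of by (simp add: eventually_blocks_def)

lemma base_of_blocks:
  assumes "compact_open A B"
  obtains n where "S.r n = blocks B" "base_of n = B"
proof -
  obtain n where "S.r n = blocks B" using S.r_surj[OF blocks_in_ring[OF assms]] by (elim exE)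
  then show thesis
    using that base_of_eq eventually_blocks_blocks[OF assms] by metis
qed

lemma base_of_nonempty: "emeasure ray_measure (S.r n) = \<infinity> \<longleftrightarrow> base_of n \<noteq> {}"
proof
  assume "base_of n \<noteq> {}"
  then show "emeasure ray_measure (S.r n) = \<infinity>"
    using emeasure_eventually_blocks[OF S.r_in eventually_blocks_base_of]
    by (simp add: emeasure_ray_block_ring)
next
  assume inf: "emeasure ray_measure (S.r n) = \<infinity>"
  show "base_of n \<noteq> {}"
  proof
    assume "base_of n = {}"
    then have "S.r n \<in> generated_ring"
      using eventually_blocks_empty[OF S.r_in[of n]] eventually_blocks_base_of[of n] by simp
    from emeasure_generated_ring[OF this] obtain d where "emeasure lborel (S.r n) = ennreal d"
      by (elim bexE)
    then show False using inf by (simp add: emeasure_ray_block_ring)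
  qed
qed

text \<open>A point of \<open>A\<close> is identified with the ultrafilter of its compact open neighbourhoods.\<close>

definition embed :: "'b \<Rightarrow> nat \<Rightarrow> bool" where
  "embed x n \<longleftrightarrow> x \<in> base_of n"

abbreviation defect :: "(nat \<Rightarrow> bool) set" where
  "defect \<equiv> defective_set S.stone S.stone_measure"

lemma mem_defect_iff: "f \<in> defect \<longleftrightarrow> f \<in> topspace S.stone \<and> (\<forall>n. f n \<longrightarrow> base_of n \<noteq> {})"
  unfolding S.defective_set_stone emeasure_space_ray_measure base_of_nonempty by simp

lemma compact_open_pattern:
  assumes "finite F" "compact_open A B"
  shows "compact_open A {y \<in> B. \<forall>n\<in>F. y \<in> base_of n \<longleftrightarrow> x \<in> base_of n}"
  using assms(1)
proof (induction F rule: finite_induct)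
  case empty
  then show ?case using assms by simp
next
  case (insert m F)
  let ?t = "{y \<in> B. \<forall>n\<in>F. y \<in> base_of n \<longleftrightarrow> x \<in> base_of n}"
  have "{y \<in> B. \<forall>n\<in>insert m F. y \<in> base_of n \<longleftrightarrow> x \<in> base_of n} =
      (if x \<in> base_of m then ?t \<inter> base_of m else ?t - base_of m)"
    by auto
  then show ?case
    using insert.IH by (simp add: compact_open_Diff compact_open_Int Hausdorff_A compact_open_base_of)
qed

lemma compact_open_containing:
  assumes "x \<in> topspace A"
  obtains n where "x \<in> base_of n"
proof -
  obtain B where B: "compact_open A B" "x \<in> B"
    using lc_zero_dim_compact_open_base[OF A openin_topspace assms] by blast
  obtain n where "base_of n = B" by (rule base_of_blocks[OF B(1)])
  then show thesis using B(2) by (intro that[of n]) simp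
qed

text \<open>For membership in the closure, a finite set \<open>F\<close> of coordinates of
  \<open>embed x\<close> must be matched by the code of a real number. The points of
  \<open>A\<close> with the same pattern on \<open>F\<close> as \<open>x\<close> contain a compact
  open set around \<open>x\<close>, so infinitely many blocks carry such a point; any of them beyond
  the thresholds of all \<open>n\<close> in \<open>F\<close> will do.\<close>

lemma embed_in_defect:
  assumes x: "x \<in> topspace A"
  shows "embed x \<in> defect"
  unfolding mem_defect_iff
proof (intro conjI allI impI)
  show "base_of n \<noteq> {}" if "embed x n" for n using that by (auto simp: embed_def)
  obtain m where m: "x \<in> base_of m" by (rule compact_open_containing[OF x])
  show "embed x \<in> topspace S.stone"
    unfolding S.topspace_stone mem_Collect_eq
  proof (intro conjI allI impI)
    show "embed x \<noteq> (\<lambda>_. False)"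
    proof
      assume "embed x = (\<lambda>_. False)"
      then have "\<not> embed x m" by simp
      then show False using m by (simp add: embed_def)
    qed
    fix F :: "nat set" assume F: "finite F"
    let ?B = "{y \<in> base_of m. \<forall>n\<in>F. y \<in> base_of n \<longleftrightarrow> x \<in> base_of n}"
    have inf: "infinite {k. pt k \<in> Some ` ?B}"
      using m by (intro infinite_Some compact_open_pattern[OF F compact_open_base_of]) auto
    have "\<exists>N::nat. \<forall>y\<ge>real N * c. y \<in> S.r n \<longleftrightarrow> y \<in> blocks (base_of n)" for n
      using eventually_blocks_base_of[of n] by (simp add: eventually_blocks_def)
    then have "\<forall>n. \<exists>N::nat. \<forall>y\<ge>real N * c. y \<in> S.r n \<longleftrightarrow> y \<in> blocks (base_of n)"
      by (rule allI)
    from choice[OF this] obtain N :: "nat \<Rightarrow> nat"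
      where N: "\<forall>n. \<forall>y\<ge>real (N n) * c. y \<in> S.r n \<longleftrightarrow> y \<in> blocks (base_of n)"
      by (elim exE)
    \<comment> \<open>The sum serves as a common upper bound of the thresholds \<open>N n\<close>
      for \<open>n\<close> in \<open>F\<close>; the left endpoint \<open>real k * c\<close>
      represents block \<open>k\<close>.\<close>
    obtain k where k: "sum N F \<le> k" "k \<in> {k. pt k \<in> Some ` ?B}"
      using inf unfolding infinite_nat_iff_unbounded_le by blast
    have "S.code (real k * c) n = embed x n" if n: "n \<in> F" for n
    proof -
      have "N n \<le> k" using k(1) member_le_sum[OF n _ F, of N] by simp
      then have "real (N n) * c \<le> real k * c" using c_pos by simp
      then have "S.code (real k * c) n \<longleftrightarrow> real k * c \<in> blocks (base_of n)"
        using N by (simp add: S.code_def)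
      also have "\<dots> \<longleftrightarrow> pt k \<in> Some ` base_of n"
        using c_pos by (simp add: mem_blocks_iff)
      also have "\<dots> \<longleftrightarrow> embed x n"
      proof -
        obtain y where y: "pt k = Some y" "y \<in> ?B" using k(2) by blast
        then have "y \<in> base_of n \<longleftrightarrow> x \<in> base_of n" using n by simp
        then show ?thesis using y(1) by (simp add: embed_def inj_image_mem_iff)
      qed
      finally show ?thesis .
    qed
    then have "S.code (real k * c) \<in> agreeing F (embed x)" by (simp add: agreeing_def)
    moreover have "real k * c \<in> space ray_measure"
      using c_pos by (simp add: space_ray_measure ray)
    ultimately show "S.code ` space ray_measure \<inter> agreeing F (embed x) \<noteq> {}" by blast
  qed
qed

lemma inj_on_embed: "inj_on embed (topspace A)"
proof (rule inj_onI)
  fix x y assume x: "x \<in> topspace A" and y: "y \<in> topspace A" and eq: "embed x = embed y"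
  show "x = y"
  proof (rule ccontr)
    assume "x \<noteq> y"
    then have "x \<in> topspace A - {y}" using x by simp
    moreover have "openin A (topspace A - {y})"
      using Hausdorff_imp_t1_space[OF Hausdorff_A] by (simp add: t1_space_openin_delete_alt)
    ultimately obtain B where B: "compact_open A B" "x \<in> B" "B \<subseteq> topspace A - {y}"
      using lc_zero_dim_compact_open_base[OF A] by blast
    obtain n where "base_of n = B" by (rule base_of_blocks[OF B(1)])
    then have "embed x n" "\<not> embed y n" using B by (auto simp: embed_def)
    then show False using eq by simp
  qed
qed

text \<open>Maximality of the ultrafilter \<open>f\<close>: it contains \<open>r m\<close> but not
  \<open>r n\<close>, hence \<open>r m - r n\<close>, whose trace avoids all points of
  \<open>base_of n\<close>.\<close>

lemma defect_Diff:
  assumes f: "f \<in> defect" "f m" "\<not> f n" and x: "x \<in> base_of n"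
  obtains k where "f k" "x \<notin> base_of k"
proof -
  obtain k where k: "S.r k = S.r m - S.r n"
    using S.r_surj[OF S.Diff[OF S.r_in S.r_in]] by blast
  have ft: "f \<in> topspace S.stone" using f(1) by (simp add: mem_defect_iff)
  have "\<exists>y\<in>space ray_measure. \<forall>i\<in>{m, n, k}. y \<in> S.r i \<longleftrightarrow> f i"
    by (rule S.stone_approx[OF ft]) simp
  then have "f k" using k f by auto
  moreover have "base_of k = base_of m - base_of n"
    using eventually_blocks_op(2)[OF eventually_blocks_base_of eventually_blocks_base_of, of m n]
    unfolding k[symmetric] by (rule base_of_eq)
  ultimately show thesis using x by (intro that[of k]) auto
qed

text \<open>The ultrafilter \<open>f\<close> contains the intersection of the given ring elements.
  Being defective, it has only members with non-empty trace, and traces are monotone.\<close>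

lemma defect_fip:
  assumes f: "f \<in> defect" and F: "finite F" "F \<noteq> {}" "\<And>n. n \<in> F \<Longrightarrow> f n"
  shows "(\<Inter>n\<in>F. base_of n) \<noteq> {}"
proof -
  have "(\<Inter>n\<in>F. S.r n) \<in> block_ring" using F(1,2)
    by (intro S.finite_INT) simp_all
  then obtain k where k: "S.r k = (\<Inter>n\<in>F. S.r n)" using S.r_surj by blast
  have ft: "f \<in> topspace S.stone" using f(1) by (simp add: mem_defect_iff)
  have "\<exists>y\<in>space ray_measure. \<forall>i\<in>insert k F. y \<in> S.r i \<longleftrightarrow> f i"
    by (rule S.stone_approx[OF ft]) (simp add: F)
  then have "f k" using k F(3) by auto
  then have "base_of k \<noteq> {}" using f by (simp add: mem_defect_iff)
  moreover have "base_of k \<subseteq> base_of n" if "n \<in> F" for n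
  proof (rule eventually_blocks_mono[OF eventually_blocks_base_of eventually_blocks_base_of])
    show "S.r k \<subseteq> S.r n" using k that by blast
  qed
  ultimately show ?thesis by blast
qed

text \<open>The traces of the members of a defective ultrafilter are closed sets with the finite
  intersection property inside the compact set \<open>base_of m\<close>, so they have a common point
  \<open>x\<close>. By maximality, in the form of \<open>defect_Diff\<close>, \<open>f\<close>
  contains every ring element whose trace contains \<open>x\<close>, so \<open>f\<close> is
  \<open>embed x\<close>.\<close>

lemma embed_surj: "embed ` topspace A = defect"
proof (intro equalityI subsetI)
  fix f assume f: "f \<in> defect"
  then have ft: "f \<in> topspace S.stone" by (simp add: mem_defect_iff)
  obtain m where m: "f m" using S.stone_nonzero[OF ft] by blast
  have "base_of m \<inter> \<Inter>(base_of ` {n. f n}) \<noteq> {}"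
  proof (rule compactin_fip[THEN iffD1, THEN conjunct2, rule_format])
    show "compactin A (base_of m)"
      using compact_open_base_of[of m] by (simp add: compact_open_def)
    have "closedin A (base_of n)" for n
      using compact_open_base_of[of n] Hausdorff_A
      by (simp add: compact_open_def compactin_imp_closedin)
    moreover have "base_of m \<inter> \<Inter>\<F> \<noteq> {}"
      if \<F>: "finite \<F> \<and> \<F> \<subseteq> base_of ` {n. f n}" for \<F>
    proof -
      obtain F where F: "F \<subseteq> {n. f n}" "finite F" "\<F> = base_of ` F"
        using \<F> finite_subset_image[of \<F> base_of "{n. f n}"] by blast
      have "f n" if "n \<in> insert m F" for n using that F(1) m by auto
      then have "(\<Inter>n\<in>insert m F. base_of n) \<noteq> {}"
        using F(2) by (intro defect_fip[OF f]) auto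
      then show ?thesis using F(3) by simp
    qed
    ultimately show "(\<forall>C\<in>base_of ` {n. f n}. closedin A C) \<and>
        (\<forall>\<F>. finite \<F> \<and> \<F> \<subseteq> base_of ` {n. f n} \<longrightarrow> base_of m \<inter> \<Inter>\<F> \<noteq> {})"
      by (intro conjI ballI allI impI) auto
  qed
  then obtain x where "x \<in> base_of m \<inter> \<Inter>(base_of ` {n. f n})" by (meson ex_in_conv)
  then have x: "x \<in> base_of m" "\<And>n. f n \<Longrightarrow> x \<in> base_of n" by simp_all
  have "f n" if n: "x \<in> base_of n" for n
  proof (rule ccontr)
    assume "\<not> f n"
    obtain k where "f k" "x \<notin> base_of k" by (rule defect_Diff[OF f m \<open>\<not> f n\<close> n])
    then show False using x(2) by simp
  qed
  then have "f = embed x"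
    by (intro ext iffI) (simp_all add: embed_def x(2))
  moreover have "x \<in> topspace A"
    using x(1) compact_open_base_of[of m] openin_subset unfolding compact_open_def by blast
  ultimately show "f \<in> embed ` topspace A" by blast
qed (use embed_in_defect in blast)

text \<open>Each coordinate of \<open>embed\<close> is the indicator of the clopen set
  \<open>base_of n\<close>.\<close>

lemma continuous_map_embed: "continuous_map A (subtopology S.stone defect) embed"
proof -
  have "continuous_map A (discrete_topology UNIV) (\<lambda>x. embed x n)" for n
    unfolding continuous_map_def
  proof (intro conjI allI impI)
    fix U :: "bool set"
    have co: "openin A (base_of n)" "closedin A (base_of n)"
      using compact_open_base_of[of n] Hausdorff_A by (auto simp: compact_open_def compactin_imp_closedin)
    have "{x \<in> topspace A. embed x n \<in> U} =
        (if True \<in> U then base_of n else {}) \<union> (if False \<in> U then topspace A - base_of n else {})"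
    proof (rule set_eqI)
      fix x show "x \<in> {x \<in> topspace A. embed x n \<in> U} \<longleftrightarrow>
        x \<in> (if True \<in> U then base_of n else {}) \<union> (if False \<in> U then topspace A - base_of n else {})"
        using openin_subset[OF co(1)] by (cases "x \<in> base_of n") (auto simp: embed_def)
    qed
    also have "openin A \<dots>"
      using co by (intro openin_Un) (auto intro: openin_diff)
    finally show "openin A {x \<in> topspace A. embed x n \<in> U}" .
  qed simp
  then have "continuous_map A cantor_topology embed"
    by (simp add: continuous_map_componentwise_UNIV)
  moreover have "embed \<in> topspace A \<rightarrow> topspace S.stone"
    using embed_in_defect mem_defect_iff by blast
  then have "embed \<in> topspace A \<rightarrow> cantor_topology closure_of (S.code ` space ray_measure) - {\<lambda>_. False}"
    unfolding S.stone_def by (simp add: Pi_iff)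
  ultimately have "continuous_map A S.stone embed"
    unfolding S.stone_def by (simp add: continuous_map_in_subtopology image_subset_iff_funcset)
  then show ?thesis
    using embed_in_defect by (simp add: continuous_map_in_subtopology Pi_iff image_subset_iff)
qed

text \<open>Every compact open \<open>B\<close> is some \<open>base_of n\<close>, and its image
  contains all of \<open>S.cyl n \<inter> defect\<close> because \<open>embed\<close> is onto the
  defective set.\<close>

lemma open_map_embed: "open_map A (subtopology S.stone defect) embed"
  unfolding open_map_def
proof (intro allI impI)
  fix V assume V: "openin A V"
  show "openin (subtopology S.stone defect) (embed ` V)"
  proof (subst openin_subopen, intro ballI)
    fix f assume "f \<in> embed ` V"
    then obtain x where x: "x \<in> V" "f = embed x" by blast
    obtain B where B: "compact_open A B" "x \<in> B" "B \<subseteq> V"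
      using lc_zero_dim_compact_open_base[OF A V x(1)] by blast
    obtain n where n: "base_of n = B" by (rule base_of_blocks[OF B(1)])
    have xt: "x \<in> topspace A" using V x(1) openin_subset by blast
    have "openin (subtopology S.stone defect) (S.cyl n \<inter> defect)"
      using S.compact_open_cyl[of n] unfolding compact_open_def openin_subtopology by blast
    moreover have "f \<in> S.cyl n \<inter> defect"
      using embed_in_defect[OF xt] x B n mem_defect_iff[of f] by (simp add: S.cyl_def embed_def)
    moreover have "S.cyl n \<inter> defect \<subseteq> embed ` V"
    proof
      fix g assume g: "g \<in> S.cyl n \<inter> defect"
      then obtain y where y: "g = embed y" using embed_surj by blast
      then have "y \<in> B" using g n by (simp add: S.cyl_def embed_def)
      then show "g \<in> embed ` V" using y B by blast
    qed
    ultimately show "\<exists>T. openin (subtopology S.stone defect) T \<and> f \<in> T \<and> T \<subseteq> embed ` V" by blast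
  qed
qed

lemma defect_homeomorphic: "subtopology S.stone defect homeomorphic_space A"
proof -
  have "defect \<subseteq> topspace S.stone" using mem_defect_iff by blast
  then have "embed ` topspace A = topspace (subtopology S.stone defect)"
    unfolding embed_surj by auto
  then have "homeomorphic_map A (subtopology S.stone defect) embed"
    by (rule bijective_open_imp_homeomorphic_map[OF continuous_map_embed open_map_embed _ inj_on_embed])
  then show ?thesis
    by (metis homeomorphic_map_imp_homeomorphic_space homeomorphic_space_sym)
qed

end

section \<open>Choice of the block length and of the points attached to the blocks\<close>

lemma exists_good_defective:
  fixes A :: "'b topology"
  assumes D: "countable_dense_group_like \<infinity> D" and A: "lc_zero_dim_metric_space A"
  shows "\<exists>(X :: (nat \<Rightarrow> bool) topology) \<mu>. noncompact_lc_Cantor X \<and> good_measure X \<mu> \<and>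
    non_defective X \<mu> \<and> compact_open_values X \<mu> = D \<and>
    subtopology X (defective_set X \<mu>) homeomorphic_space A"
proof -
  interpret V: group_like_values \<top> D
    using D by unfold_locales simp_all
  obtain c where c: "c \<in> D" "0 < c"
  proof -
    have "1 \<in> real_ray \<top>" by (simp add: real_ray_def)
    \<comment> \<open>Any element of \<open>D\<close> at distance less than 1 from 1 is
      positive.\<close>
    then obtain c where "c \<in> D" "\<bar>c - 1\<bar> < 1" using V.D_approx[of 1 1] by auto
    then show ?thesis by (intro that[of c]) auto
  qed
  \<comment> \<open>One point is selected from each of the countably many compact open sets; letting
    every label recur infinitely often makes each non-empty \<open>B\<close> be visited infinitely
    often. The arbitrary label arising from the empty set does no harm.\<close>
  define S where "S = insert None (Some ` (\<lambda>B. SOME x. x \<in> B) ` {B. compact_open A B})"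
  have "countable {B. compact_open A B}"
    using A by (intro countable_compact_open) (simp add: lc_zero_dim_metric_space_def)
  then have "countable S" "S \<noteq> {}" unfolding S_def by simp_all
  from countable_recurrent_sequence[OF this]
  obtain pt :: "nat \<Rightarrow> 'b option" where pt: "\<forall>s\<in>S. infinite {n. pt n = s}"
    by (elim exE)
  interpret P: prescribed_defect D A c pt
  proof (unfold_locales)
    show "infinite {n. pt n = None}" by (rule pt[rule_format]) (simp add: S_def)
    fix B assume B: "compact_open A B" "B \<noteq> {}"
    let ?x = "SOME x. x \<in> B"
    have "?x \<in> B" using B(2) by (simp add: some_in_eq)
    then have "{n. pt n = Some ?x} \<subseteq> {n. pt n \<in> Some ` B}" by auto
    moreover have "infinite {n. pt n = Some ?x}" using B(1) by (intro pt[rule_format]) (auto simp: S_def)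
    ultimately show "infinite {n. pt n \<in> Some ` B}" by (metis finite_subset)
  qed (use A c in auto)
  have "non_defective P.S.stone P.S.stone_measure"
    by (rule P.S.non_defective_stone) (simp add: V.emeasure_space_ray_measure)
  then show ?thesis
    by (intro exI[of _ P.S.stone] exI[of _ P.S.stone_measure] conjI P.S.noncompact_lc_Cantor_stone
        P.S.good_stone P.block_ring_values P.defect_homeomorphic)
qed

theorem theorem2p10:
  shows "(\<forall>(X :: 'a topology) \<mu>.
            noncompact_lc_Cantor X \<and> \<mu> \<in> meas_M0 X \<and> good_measure X \<mu> \<longrightarrow>
              countable_dense_group_like (emeasure \<mu> (topspace X)) (compact_open_values X \<mu>) \<and>
              lc_zero_dim_metric_space (subtopology X (defective_set X \<mu>)))
       \<and> (\<forall>D. countable_dense_group_like 1 D \<longrightarrow>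
            (\<exists>(X :: (nat \<Rightarrow> bool) topology) \<mu>.
               noncompact_lc_Cantor X \<and> good_measure X \<mu> \<and> prob_space \<mu> \<and>
               compact_open_values X \<mu> = D))
       \<and> (\<forall>D (A :: 'b topology).
            countable_dense_group_like \<infinity> D \<and> lc_zero_dim_metric_space A \<longrightarrow>
            (\<exists>(X :: (nat \<Rightarrow> bool) topology) \<mu>.
               noncompact_lc_Cantor X \<and> good_measure X \<mu> \<and> non_defective X \<mu> \<and>
               compact_open_values X \<mu> = D \<and>
               subtopology X (defective_set X \<mu>) homeomorphic_space A))"
proof (intro conjI allI impI)
  fix X :: "'a topology" and \<mu> :: "'a measure"
  assume "noncompact_lc_Cantor X \<and> \<mu> \<in> meas_M0 X \<and> good_measure X \<mu>"
  then interpret good_measure_on_noncompact_Cantor X \<mu>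
    by (intro good_measure_on_noncompact_Cantor.intro) simp_all
  show "countable_dense_group_like (emeasure \<mu> (topspace X)) (compact_open_values X \<mu>)"
    by (rule values_group_like)
  show "lc_zero_dim_metric_space (subtopology X (defective_set X \<mu>))"
    by (rule defective_set_lc_zero_dim)
next
  fix D assume "countable_dense_group_like 1 D"
  then show "\<exists>(X :: (nat \<Rightarrow> bool) topology) \<mu>. noncompact_lc_Cantor X \<and> good_measure X \<mu> \<and>
      prob_space \<mu> \<and> compact_open_values X \<mu> = D"
    by (rule exists_good_probability)
next
  fix D and A :: "'b topology"
  assume "countable_dense_group_like \<infinity> D \<and> lc_zero_dim_metric_space A"
  then show "\<exists>(X :: (nat \<Rightarrow> bool) topology) \<mu>. noncompact_lc_Cantor X \<and> good_measure X \<mu> \<and>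
      non_defective X \<mu> \<and> compact_open_values X \<mu> = D \<and>
      subtopology X (defective_set X \<mu>) homeomorphic_space A"
    by (elim conjE) (rule exists_good_defective)
qed

end
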